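(* Assume the learning-rate assumption and the smoothness assumption stated in the context. Let $\rho_t$ be a weak solution of $\partial_t\rho_t=2\zeta(t)\nabla_\omega\cdot\big(\rho_t\nabla_\omega\Phi(\omega;\rho_t)\big)$. Then $$\frac{d}{dt}\mathcal E(\rho_t)=-2\zeta(t)\,\mathcal I(\rho_t)\le0,\qquad \mathcal I(\rho)=\int\|\nabla_\omega\Phi(\omega;\rho)\|^2\,\rho(d\omega).$$ Consequently, $t\mapsto\mathcal E(\rho_t)$ is non-increasing.
   Context: Model. Fix positive integers $L,d_x,d_k,d_v$ and a fixed matrix $W_{\mathrm{out}}\in\mathbb R^{d_x\times d_v}$. A head parameter is $\omega=(W_Q,W_K,W_V,W_O)\in\mathbb R^{d_x\times d_k}\times\mathbb R^{d_x\times d_k}\times\mathbb R^{d_x\times d_k}\times\mathbb R^{d_k\times d_x}$, identified with a vector in $\mathbb R^{d_\omega}$. For an input $X\in\mathbb R^{L\times d_x}$ (rows are tokens), the causally masked attention matrix $A_\omega(X)\in\mathbb R^{L\times L}$ has entries $$A_\omega(X)_{rs}=\frac{\exp\big((XW_QW_K^\top X^\top)_{rs}/\sqrt{d_k}\big)}{\sum_{s'\le r}\exp\big((XW_QW_K^\top X^\top)_{rs'}/\sqrt{d_k}\big)}\ (s\le r),\qquad A_\omega(X)_{rs}=0\ (s>r).$$ $\psi_l(X;\omega)\in\mathbb R^{d_v}$ is the $l$-th row of $A_\omega(X)XW_VW_OW_{\mathrm{out}}$, $l=1,\dots,L$. Data and risk. $X$ is a random input and $Y_l(X)\in\mathbb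 R^{d_v}$ is a one-hot label for each $l$; $\mathbb E_X$ is expectation over $X$. $\mathrm{softmax}_j(z)=e^{z_j}/\sum_m e^{z_m}$. For a probability measure $\rho$ on $\mathbb R^{d_\omega}$, $z_l^\rho(X)=\int\psi_l(X;\omega)\,\rho(d\omega)$. The cross-entropy loss is $\ell(y,z)=\log\big(\sum_{j=1}^{d_v}e^{z_j}\big)-y^\top z$, the risk is $\mathcal E(\rho)=\mathbb E_X\big[\frac1L\sum_{l=1}^L\ell(Y_l(X),z_l^\rho(X))\big]$, and its first variation is $$\Phi(\omega;\rho)=\mathbb E_X\Big[\frac1L\sum_{l=1}^L\big\langle\mathrm{softmax}(z_l^\rho(X))-Y_l(X),\psi_l(X;\omega)\big\rangle\Big].$$ Weak solution. A narrowly continuous curve $t\mapsto\rho_t\in\mathcal P(K)$ such that for every $f\in C^1(K)$, $\frac{d}{dt}\int f\,d\rho_t=-2\zeta(t)\int\langle\nabla f(\omega),\nabla_\omega\Phi(\omega;\rho_t)\rangle\,\rho_t(d\omega)$ in the sense of distributions in time. Learning-rate assumption. $\zeta:[0,\infty)\to[0,\infty)$ is bounded and Lipschitz, and $\int_0^\infty\zeta(t)\,dt=\infty$. Smoothness assumption. $K\subset\mathbb R^{d_\omega}$ and $K_x\subset\mathbb R^{d_x}$ are compact, all measures considered are supported in $K$, all input tokens lie in $K_x$ (so $X\in K_x^L$), the maps $\omega\mapsto\psi_l(X;\omega)$ are $C^3$ on $K$ for all $l$ and almost every $X$, and there is $B_\psi<\infty$ with $$\sup_{X\in K_x^L,\,1\le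 l\le L,\,\omega\in K}\big(\|\psi_l(X;\omega)\|+\|\nabla_\omega\psi_l(X;\omega)\|+\|\nabla^2_\omega\psi_l(X;\omega)\|+\|\nabla^3_\omega\psi_l(X;\omega)\|\big)\le B_\psi.$$ *)

theory Defs
  imports "HOL-Probability.Probability"
begin

section \<open>The attention head\<close>

text \<open>A matrix of type \<open>real^'m^'n\<close> has its rows indexed by \<open>'n\<close> and its columns by \<open>'m\<close>.
  Token positions form a finite linear order \<open>'l\<close>, which the causal mask refers to; the tokens are
  the rows of an input \<open>X :: real^'dx^'l\<close>.

  A head parameter is \<open>(W_Q, W_K, W_V, W_O)\<close>; the norm and inner product of this product type are
  the Euclidean ones of the vector of all matrix entries.\<close>

type_synonym ('dx, 'dk) head =
  "(real^'dk^'dx) \<times> (real^'dk^'dx) \<times> (real^'dk^'dx) \<times> (real^'dx^'dk)"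

definition attn_score ::
  "('dx::finite, 'dk::finite) head \<Rightarrow> real^'dx^'l \<Rightarrow> real^'l^('l::finite)" where
  "attn_score \<omega> X =
     (case \<omega> of (WQ, WK, WV, WO) \<Rightarrow> X ** WQ ** transpose WK ** transpose X)"

definition attn ::
  "('dx::finite, 'dk::finite) head \<Rightarrow> real^'dx^('l::{finite,linorder})
     \<Rightarrow> real^('l::{finite,linorder})^('l::{finite,linorder})" where
  "attn \<omega> X = (\<chi> r s. if s \<le> r
     then exp (attn_score \<omega> X $ r $ s / sqrt (real CARD('dk)))
            / (\<Sum>s'\<in>{..r}. exp (attn_score \<omega> X $ r $ s' / sqrt (real CARD('dk))))
     else 0)"

definition psi ::
  "real^('dv::finite)^'dx \<Rightarrow> 'l \<Rightarrow> real^'dx^('l::{finite,linorder})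
     \<Rightarrow> ('dx::finite, 'dk::finite) head \<Rightarrow> real^'dv" where
  "psi Wout l X \<omega> =
     (case \<omega> of (WQ, WK, WV, WO) \<Rightarrow> row l (attn \<omega> X ** X ** WV ** WO ** Wout))"

section \<open>Risk and first variation\<close>

definition softmax :: "real^('n::finite) \<Rightarrow> real^'n" where
  "softmax z = (\<chi> j. exp (z $ j) / (\<Sum>m\<in>UNIV. exp (z $ m)))"

definition cross_entropy :: "real^('n::finite) \<Rightarrow> real^'n \<Rightarrow> real" where
  "cross_entropy y z = ln (\<Sum>j\<in>UNIV. exp (z $ j)) - y \<bullet> z"

definition one_hot :: "real^('n::finite) \<Rightarrow> bool" where
  "one_hot y \<longleftrightarrow> (\<exists>j. y = axis j 1)"

definition logits ::
  "real^('dv::finite)^'dx \<Rightarrow> ('dx::finite, 'dk::finite) head measure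
     \<Rightarrow> 'l \<Rightarrow> real^'dx^('l::{finite,linorder}) \<Rightarrow> real^'dv" where
  "logits Wout \<rho> l X = (LINT \<omega>|\<rho>. psi Wout l X \<omega>)"

text \<open>\<open>D\<close> is the law of the random input, so expectations over the input are integrals
  against \<open>D\<close>; \<open>Y l X\<close> is the label of position \<open>l\<close>.\<close>

definition risk ::
  "real^('dv::finite)^'dx \<Rightarrow> (real^'dx^('l::{finite,linorder})) measure
     \<Rightarrow> ('l \<Rightarrow> real^'dx^('l::{finite,linorder}) \<Rightarrow> real^'dv)
     \<Rightarrow> ('dx::finite, 'dk::finite) head measure \<Rightarrow> real" where
  "risk Wout D Y \<rho> =
     (LINT X|D. (1 / real CARD('l)) * (\<Sum>l\<in>UNIV. cross_entropy (Y l X) (logits Wout \<rho> l X)))"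

definition first_variation ::
  "real^('dv::finite)^'dx \<Rightarrow> (real^'dx^('l::{finite,linorder})) measure
     \<Rightarrow> ('l \<Rightarrow> real^'dx^('l::{finite,linorder}) \<Rightarrow> real^'dv)
     \<Rightarrow> ('dx::finite, 'dk::finite) head measure \<Rightarrow> ('dx, 'dk) head \<Rightarrow> real" where
  "first_variation Wout D Y \<rho> \<omega> =
     (LINT X|D. (1 / real CARD('l)) *
        (\<Sum>l\<in>UNIV. (softmax (logits Wout \<rho> l X) - Y l X) \<bullet> psi Wout l X \<omega>))"

section \<open>Differentiability on a compact set\<close>

definition grad :: "('a::real_inner \<Rightarrow> real) \<Rightarrow> 'a \<Rightarrow> 'a" where
  "grad f x = (THE g. GDERIV f x :> g)"

text \<open>Derivatives as bounded linear maps, so that taking derivatives can be iterated;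
  \<open>norm (D\<^sup>k f x)\<close> is then the operator norm of the \<open>k\<close>-th derivative.\<close>

definition fderiv ::
  "('a::real_normed_vector \<Rightarrow> 'b::real_normed_vector) \<Rightarrow> 'a \<Rightarrow> ('a \<Rightarrow>\<^sub>L 'b)" where
  "fderiv f x = Blinfun (frechet_derivative f (at x))"

text \<open>A function is \<open>C\<^sup>k\<close> on an arbitrary set \<open>K\<close> if it is \<open>C\<^sup>k\<close> on an open neighbourhood of \<open>K\<close>.\<close>

definition C1_on :: "'a::real_normed_vector set \<Rightarrow> ('a \<Rightarrow> 'b::real_normed_vector) \<Rightarrow> bool" where
  "C1_on K f \<longleftrightarrow> (\<exists>U. open U \<and> K \<subseteq> U \<and> f differentiable_on U \<and> continuous_on U (fderiv f))"

definition C3_on :: "'a::real_normed_vector set \<Rightarrow> ('a \<Rightarrow> 'b::real_normed_vector) \<Rightarrow> bool" where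
  "C3_on K f \<longleftrightarrow> (\<exists>U. open U \<and> K \<subseteq> U \<and>
     f differentiable_on U \<and> fderiv f differentiable_on U \<and>
     fderiv (fderiv f) differentiable_on U \<and> continuous_on U (fderiv (fderiv (fderiv f))))"

section \<open>Weak solutions\<close>

text \<open>For closed \<open>K\<close>, these are the Borel probability measures with support in \<open>K\<close>.\<close>

definition prob_measures_on :: "'a::topological_space set \<Rightarrow> 'a measure set" where
  "prob_measures_on K =
     {\<rho>. prob_space \<rho> \<and> sets \<rho> = sets borel \<and> (AE x in \<rho>. x \<in> K)}"

definition narrowly_continuous_on ::
  "real set \<Rightarrow> (real \<Rightarrow> 'a::topological_space measure) \<Rightarrow> bool" where
  "narrowly_continuous_on T \<rho> \<longleftrightarrow>
     (\<forall>f :: 'a \<Rightarrow> real. continuous_on UNIV f \<and> bounded (range f) \<longrightarrow>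
        continuous_on T (\<lambda>t. LINT x|\<rho> t. f x))"

text \<open>The test functions \<open>C\<^sub>c\<^sup>\<infinity>(0,\<infinity>)\<close>, extended by zero.\<close>

definition time_test_function :: "(real \<Rightarrow> real) \<Rightarrow> bool" where
  "time_test_function \<phi> \<longleftrightarrow>
     (\<forall>n t. ((deriv ^^ n) \<phi>) differentiable (at t)) \<and>
     (\<exists>a b. 0 < a \<and> (\<forall>t. t \<notin> {a..b} \<longrightarrow> \<phi> t = 0))"

definition has_distributional_derivative :: "(real \<Rightarrow> real) \<Rightarrow> (real \<Rightarrow> real) \<Rightarrow> bool" where
  "has_distributional_derivative F G \<longleftrightarrow>
     (\<forall>\<phi>. time_test_function \<phi> \<longrightarrow>
        (LINT t:{0<..}|lborel. deriv \<phi> t * F t) = - (LINT t:{0<..}|lborel. \<phi> t * G t))"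

text \<open>The integrals against \<open>\<rho> t\<close> are restricted to \<open>K\<close> because a function that is \<open>C\<^sup>1\<close> on \<open>K\<close> is
  unconstrained (possibly not even measurable) away from \<open>K\<close>.\<close>

definition weak_solution ::
  "real^('dv::finite)^'dx \<Rightarrow> (real^'dx^('l::{finite,linorder})) measure
     \<Rightarrow> ('l \<Rightarrow> real^'dx^('l::{finite,linorder}) \<Rightarrow> real^'dv)
     \<Rightarrow> ('dx::finite, 'dk::finite) head set \<Rightarrow> (real \<Rightarrow> real)
     \<Rightarrow> (real \<Rightarrow> ('dx, 'dk) head measure) \<Rightarrow> bool" where
  "weak_solution Wout D Y K \<zeta> \<rho> \<longleftrightarrow>
     (\<forall>t\<ge>0. \<rho> t \<in> prob_measures_on K) \<and>
     narrowly_continuous_on {0..} \<rho> \<and>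
     (\<forall>f :: ('dx, 'dk) head \<Rightarrow> real. C1_on K f \<longrightarrow>
        has_distributional_derivative
          (\<lambda>t. LINT \<omega>:K|\<rho> t. f \<omega>)
          (\<lambda>t. - 2 * \<zeta> t *
             (LINT \<omega>:K|\<rho> t. grad f \<omega> \<bullet> grad (first_variation Wout D Y (\<rho> t)) \<omega>)))"

definition dissipation ::
  "real^('dv::finite)^'dx \<Rightarrow> (real^'dx^('l::{finite,linorder})) measure
     \<Rightarrow> ('l \<Rightarrow> real^'dx^('l::{finite,linorder}) \<Rightarrow> real^'dv)
     \<Rightarrow> ('dx::finite, 'dk::finite) head measure \<Rightarrow> real" where
  "dissipation Wout D Y \<rho> =
     (LINT \<omega>|\<rho>. (norm (grad (first_variation Wout D Y \<rho>) \<omega>))\<^sup>2)"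

section \<open>Standing assumptions\<close>

definition learning_rate :: "(real \<Rightarrow> real) \<Rightarrow> bool" where
  "learning_rate \<zeta> \<longleftrightarrow>
     (\<forall>t\<ge>0. 0 \<le> \<zeta> t) \<and> bounded (\<zeta> ` {0..}) \<and> (\<exists>C. C-lipschitz_on {0..} \<zeta>) \<and>
     (\<integral>\<^sup>+t\<in>{0..}. ennreal (\<zeta> t) \<partial>lborel) = \<infinity>"

definition data_model ::
  "(real^'dx^'l) measure
     \<Rightarrow> ('l \<Rightarrow> real^('dx::finite)^('l::finite) \<Rightarrow> real^('dv::finite)) \<Rightarrow> bool" where
  "data_model D Y \<longleftrightarrow>
     prob_space D \<and> sets D = sets borel \<and>
     (\<forall>l. Y l \<in> borel_measurable borel) \<and> (\<forall>l X. one_hot (Y l X))"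

definition smoothness ::
  "real^('dv::finite)^'dx \<Rightarrow> (real^'dx^('l::{finite,linorder})) measure
     \<Rightarrow> ('dx::finite, 'dk::finite) head set \<Rightarrow> (real^'dx) set \<Rightarrow> bool" where
  "smoothness Wout D K Kx \<longleftrightarrow>
     compact K \<and> compact Kx \<and>
     (AE X in D. \<forall>l. X $ l \<in> Kx) \<and>
     (AE X in D. \<forall>l. C3_on K (psi Wout l X :: ('dx, 'dk) head \<Rightarrow> real^'dv)) \<and>
     (\<exists>B. \<forall>(X :: real^'dx^('l::{finite,linorder})) l. \<forall>\<omega>\<in>K. (\<forall>l'. X $ l' \<in> Kx) \<longrightarrow>
        norm (psi Wout l X \<omega>)
        + norm (fderiv (psi Wout l X) \<omega>)
        + norm (fderiv (fderiv (psi Wout l X)) \<omega>)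
        + norm (fderiv (fderiv (fderiv (psi Wout l X))) \<omega>) \<le> B)"

end

theory Submission
  imports Defs "HOL-Computational_Algebra.Polynomial"
begin

text \<open>Every logit is the integral over \<open>\<rho> t\<close> of a coordinate of \<open>psi Wout l X\<close>, which is an admissible
  test function, so the weak equation yields its distributional time derivative
  \<open>-2 \<zeta> t \<integral> \<nabla>psi \<bullet> \<nabla>\<Phi> d\<rho> t\<close>. By narrow continuity this derivative is continuous in time, hence a
  classical one by the lemma of du Bois-Reymond. The gradient of the cross entropy in the logits is
  \<open>softmax - Y\<close>, and the expected sum of \<open>(softmax - Y) \<bullet> \<nabla>psi\<close> is \<open>\<nabla>\<Phi>\<close>; differentiating the risk
  under the expectation and exchanging the integrals therefore gives \<open>-2 \<zeta> t \<integral> |\<nabla>\<Phi>|\<^sup>2 d\<rho> t\<close>.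
  All the bounds needed come from compactness, since \<open>psi\<close> and its parameter gradient are jointly
  continuous in input and parameter.\<close>

section \<open>Smooth bump functions\<close>

text \<open>The risk is not linear in the measure, and its natural test function
  \<open>first_variation Wout D Y (\<rho> t)\<close> moves with time, so the weak equation cannot be
  tested with it directly. For a fixed input the logits are linear in the measure and have a test
  function independent of time; the nonlinearity is then left to an ordinary chain rule for each
  input. The same difficulty returns when the right-hand side has to be continuous in time, since
  its integrand contains a gradient depending on \<open>\<rho> t\<close>. There Fubini replaces it
  by an average, over a second input, of residuals times integrals of fixed continuous functions, to
  which narrow continuity does apply. Labels are only measurable in the input, so nothing is ever
  continuous in the input after a residual enters; what remains is measurability and dominated
  convergence. Working relative to \<open>{0..}\<close> makes time 0 part of the statement, with a
  one-sided derivative.\<close>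

definition flat :: "real poly \<Rightarrow> real \<Rightarrow> real" where
  "flat p x = (if 0 < x then poly p (inverse x) * exp (- inverse x) else 0)"

lemma tendsto_poly_times_exp_uminus: "((\<lambda>y::real. poly p y * exp (- y)) \<longlongrightarrow> 0) at_top"
proof -
  have "((\<lambda>y. \<Sum>i\<le>degree p. coeff p i * (y ^ i / exp y)) \<longlongrightarrow> (\<Sum>i\<le>degree p. coeff p i * 0)) at_top"
    by (intro tendsto_intros tendsto_power_div_exp_0)
  then show ?thesis
    by (simp add: poly_altdef exp_minus sum_distrib_right divide_inverse mult.assoc)
qed

text \<open>With y = 1/x, differentiating p(y) exp(-y) in x gives y^2 (p(y) - p'(y)) exp(-y), which
  is again of the form \<open>flat\<close>. At the origin the exponential beats every polynomial in
  y, so both one-sided difference quotients tend to 0.\<close>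

lemma has_derivative_flat:
  "(flat p has_real_derivative flat (monom 1 2 * (p - pderiv p)) x) (at x)"
proof -
  consider "x > 0" | "x < 0" | "x = 0" by linarith
  then show ?thesis
  proof cases
    case 1
    have "((\<lambda>x. poly p (inverse x) * exp (- inverse x)) has_real_derivative
            flat (monom 1 2 * (p - pderiv p)) x) (at x)"
      using 1 by (auto intro!: derivative_eq_intros
          simp: flat_def poly_monom field_simps power2_eq_square)
    then show ?thesis
      by (rule DERIV_cong_ev[THEN iffD1, rotated -1])
         (use 1 in \<open>auto simp: flat_def eventually_nhds intro!: exI[of _ "{0<..}"]\<close>)
  next
    case 2
    have "((\<lambda>x. 0) has_real_derivative flat (monom 1 2 * (p - pderiv p)) x) (at x)"
      using 2 by (simp add: flat_def)
    then show ?thesis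
      by (rule DERIV_cong_ev[THEN iffD1, rotated -1])
         (use 2 in \<open>auto simp: flat_def eventually_nhds intro!: exI[of _ "{..<0}"]\<close>)
  next
    case 3
    have r: "((\<lambda>h. flat p h / h) \<longlongrightarrow> 0) (at_right 0)"
    proof -
      \<comment> \<open>Dividing by h multiplies the polynomial by its own variable, hence
        \<open>pCons 0 p\<close>.\<close>
      have "((\<lambda>h. poly (pCons 0 p) (inverse h) * exp (- inverse h)) \<longlongrightarrow> 0) (at_right (0::real))"
        by (rule filterlim_compose[OF tendsto_poly_times_exp_uminus filterlim_inverse_at_top_right])
      then show ?thesis
        by (rule tendsto_cong[THEN iffD1, rotated])
           (auto simp: eventually_at_right_less flat_def field_simps intro!: eventually_at_rightI[of 0 1])
    qed
    have l: "((\<lambda>h. flat p h / h) \<longlongrightarrow> 0) (at_left 0)"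
      by (rule tendsto_cong[THEN iffD1, OF _ tendsto_const])
         (auto simp: flat_def intro!: eventually_at_leftI[of "-1" 0])
    show ?thesis
      using l r 3 by (simp add: DERIV_def flat_def filterlim_at_split)
  qed
qed

text \<open>A class closed under differentiation: one derivative inside the class yields all
  iterated ones by induction. Clause \<open>affine\<close> provides shifts and rescalings, and
  \<open>antiderivative\<close> provides smooth steps as primitives of bumps.\<close>

inductive elem_smooth :: "(real \<Rightarrow> real) \<Rightarrow> bool" where
  flat: "elem_smooth (flat p)"
| const: "elem_smooth (\<lambda>x. c)"
| add: "elem_smooth f \<Longrightarrow> elem_smooth g \<Longrightarrow> elem_smooth (\<lambda>x. f x + g x)"
| mult: "elem_smooth f \<Longrightarrow> elem_smooth g \<Longrightarrow> elem_smooth (\<lambda>x. f x * g x)"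
| affine: "elem_smooth f \<Longrightarrow> elem_smooth (\<lambda>x. f (a * x + b))"
| antiderivative: "elem_smooth f \<Longrightarrow> (\<And>x. (g has_real_derivative f x) (at x)) \<Longrightarrow> elem_smooth g"

lemma elem_smooth_derivative:
  "elem_smooth f \<Longrightarrow> \<exists>g. elem_smooth g \<and> (\<forall>x. (f has_real_derivative g x) (at x))"
proof (induction rule: elem_smooth.induct)
  case (flat p)
  show ?case using has_derivative_flat elem_smooth.flat by blast
next
  case (const c)
  show ?case by (rule exI[of _ "\<lambda>x. 0"]) (auto intro: elem_smooth.const)
next
  case (add f g)
  then obtain f' g' where "elem_smooth f'" "elem_smooth g'"
    "\<And>x. (f has_real_derivative f' x) (at x)" "\<And>x. (g has_real_derivative g' x) (at x)" by blast
  then show ?case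
    by (intro exI[of _ "\<lambda>x. f' x + g' x"]) (auto intro!: elem_smooth.add derivative_eq_intros)
next
  case (mult f g)
  then obtain f' g' where "elem_smooth f'" "elem_smooth g'"
    "\<And>x. (f has_real_derivative f' x) (at x)" "\<And>x. (g has_real_derivative g' x) (at x)" by blast
  with mult show ?case
    by (intro exI[of _ "\<lambda>x. f' x * g x + g' x * f x"])
       (auto intro!: elem_smooth.add elem_smooth.mult DERIV_mult)
next
  case (affine f a b)
  then obtain f' where f': "elem_smooth f'" "\<And>x. (f has_real_derivative f' x) (at x)" by blast
  then show ?case
    by (intro exI[of _ "\<lambda>x. f' (a * x + b) * a"])
       (auto intro!: elem_smooth.mult elem_smooth.affine elem_smooth.const DERIV_chain'[OF _ f'(2), unfolded mult.commute[of a]] derivative_eq_intros)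
next
  case (antiderivative f g)
  then show ?case by blast
qed

lemma elem_smooth_deriv_funpow:
  assumes "elem_smooth f"
  shows "elem_smooth ((deriv ^^ n) f)"
proof (induction n)
  case 0
  show ?case using assms by simp
next
  case (Suc n)
  obtain g where g: "elem_smooth g" "\<And>x. ((deriv ^^ n) f has_real_derivative g x) (at x)"
    using elem_smooth_derivative[OF Suc] by blast
  then have "deriv ((deriv ^^ n) f) = g"
    by (intro ext DERIV_imp_deriv)
  with g show ?case by simp
qed

lemma elem_smooth_differentiable:
  "elem_smooth f \<Longrightarrow> (deriv ^^ n) f differentiable (at t)"
  using elem_smooth_derivative[OF elem_smooth_deriv_funpow] real_differentiable_def by blast

lemma continuous_antiderivative_real:
  fixes f :: "real \<Rightarrow> real"
  assumes "continuous_on UNIV f"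
  obtains g where "\<And>x. (g has_real_derivative f x) (at x)"
proof
  fix x
  \<comment> \<open>The window contains the base point 0 and has x in its interior, so the
    derivative relative to it is two-sided.\<close>
  have "((\<lambda>u. LBINT y=0..u. f y) has_vector_derivative f x) (at x within {- \<bar>x\<bar> - 1..\<bar>x\<bar> + 1})"
    using interval_integral_FTC2[of "- \<bar>x\<bar> - 1" 0 "\<bar>x\<bar> + 1" f x, OF _ _ continuous_on_subset[OF assms]]
    by (simp add: zero_ereal_def)
  moreover have "at x within {- \<bar>x\<bar> - 1..\<bar>x\<bar> + 1} = at x"
    by (rule at_within_interior) (auto simp: interior_atLeastAtMost_real)
  ultimately show "((\<lambda>u. LBINT y=0..u. f y) has_real_derivative f x) (at x)"
    by (simp add: has_real_derivative_iff_has_vector_derivative)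
qed

section \<open>The lemma of du Bois-Reymond\<close>

lemma integrable_lborel_compact_support:
  fixes f :: "real \<Rightarrow> real"
  assumes "continuous_on UNIV f" "\<And>x. x \<notin> {a..b} \<Longrightarrow> f x = 0"
  shows "integrable lborel f"
proof -
  have "integrable lborel (\<lambda>x. indicator {a..b} x *\<^sub>R f x)"
    by (intro borel_integrable_compact continuous_on_subset[OF assms(1)]) auto
  also have "(\<lambda>x. indicator {a..b} x *\<^sub>R f x) = f"
    using assms(2) by (force simp: indicator_def)
  finally show ?thesis .
qed

lemma integral_derivative_compact_support:
  fixes g :: "real \<Rightarrow> real"
  assumes "\<And>x. (g has_real_derivative g' x) (at x)" "continuous_on UNIV g'"
    and "a \<le> b" "\<And>x. x \<notin> {a..b} \<Longrightarrow> g' x = 0"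
  shows "(LBINT x. g' x) = g b - g a"
proof -
  have "(LBINT x. g' x) = (LBINT x. g' x * indicator {a..b} x)"
    using assms(4) by (intro Bochner_Integration.integral_cong) (auto simp: indicator_def)
  also have "\<dots> = g b - g a"
    using assms by (intro integral_FTC_Icc_real) (auto simp: continuous_on_eq_continuous_at)
  finally show ?thesis .
qed

lemma elem_smooth_continuous: "elem_smooth f \<Longrightarrow> continuous_on UNIV f"
  by (meson elem_smooth_derivative DERIV_isCont continuous_at_imp_continuous_on)

text \<open>\<open>flat 1\<close> is exp(-1/x) on the positive axis; its product with its reflection
  about 1/2 is positive exactly on (0,1). The integral is positive because a primitive increases
  strictly.\<close>

lemma smooth_bump:
  obtains \<beta> where "elem_smooth \<beta>" "\<And>x. x \<notin> {0..1} \<Longrightarrow> \<beta> x = 0" "(LBINT x. \<beta> x) > 0"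
proof -
  define \<beta> where "\<beta> x = flat 1 x * flat 1 (- 1 * x + 1)" for x
  have sm: "elem_smooth \<beta>"
    unfolding \<beta>_def by (intro elem_smooth.mult elem_smooth.affine elem_smooth.flat)
  have supp: "\<beta> x = 0" if "x \<notin> {0..1}" for x
    using that by (auto simp: \<beta>_def flat_def)
  have pos: "\<beta> x > 0" if "0 < x" "x < 1" for x
    using that by (auto simp: \<beta>_def flat_def)
  obtain g where g: "\<And>x. (g has_real_derivative \<beta> x) (at x)"
    using continuous_antiderivative_real[OF elem_smooth_continuous[OF sm]] by blast
  have "g 0 < g 1"
  proof (rule DERIV_pos_imp_increasing_open[of 0 1 g])
    show "\<exists>y. (g has_real_derivative y) (at x) \<and> y > 0" if "0 < x" "x < 1" for x
      using g pos[OF that] by blast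
    show "continuous_on {0..1} g"
      by (intro continuous_at_imp_continuous_on ballI DERIV_isCont[OF g])
  qed simp
  moreover have "(LBINT x. \<beta> x) = g 1 - g 0"
    by (rule integral_derivative_compact_support[OF g elem_smooth_continuous[OF sm] _ supp]) auto
  ultimately show ?thesis
    using that[OF sm supp] by simp
qed

text \<open>The kernel sees only points of [c, c+1], where H is bounded by compactness, so dominated
  convergence applies. Since it looks only to the right of c, mollifying at a positive time never
  reaches nonpositive times.\<close>

lemma mollifier_tendsto:
  fixes H \<beta> :: "real \<Rightarrow> real"
  assumes H: "continuous_on UNIV H" and \<beta>: "continuous_on UNIV \<beta>" "\<And>x. x \<notin> {0..1} \<Longrightarrow> \<beta> x = 0"
  shows "(\<lambda>n. LBINT s. \<beta> s * H (c + inverse (Suc n) * s)) \<longlonglongrightarrow> (LBINT s. \<beta> s) * H c"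
proof -
  have "compact (H ` {c..c+1})"
    by (intro compact_continuous_image continuous_on_subset[OF H]) auto
  then obtain M where M: "\<And>x. x \<in> {c..c+1} \<Longrightarrow> \<bar>H x\<bar> \<le> M"
    by (metis compact_imp_bounded bounded_iff imageI real_norm_def)
  have [measurable]: "H \<in> borel_measurable borel" "\<beta> \<in> borel_measurable borel"
    using H \<beta>(1) by (auto intro: borel_measurable_continuous_onI)
  have "(\<lambda>n. LBINT s. \<beta> s * H (c + inverse (Suc n) * s)) \<longlonglongrightarrow> (LBINT s. \<beta> s * H c)"
  proof (rule integral_dominated_convergence)
    show "integrable lborel (\<lambda>s. M * \<bar>\<beta> s\<bar>)"
      using integrable_lborel_compact_support[OF \<beta>] by auto
    show "AE s in lborel. (\<lambda>n. \<beta> s * H (c + inverse (Suc n) * s)) \<longlonglongrightarrow> \<beta> s * H c"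
    proof (intro AE_I2 tendsto_mult tendsto_const)
      fix s :: real
      have "(\<lambda>n. c + inverse (Suc n) * s) \<longlonglongrightarrow> c + 0 * s"
        by (intro tendsto_intros LIMSEQ_inverse_real_of_nat)
      moreover have "isCont H c" using H by (simp add: continuous_on_eq_continuous_at)
      ultimately show "(\<lambda>n. H (c + inverse (Suc n) * s)) \<longlonglongrightarrow> H c"
        using isCont_tendsto_compose[of c H "\<lambda>n. c + inverse (Suc n) * s"] by simp
    qed
    fix n
    have "\<bar>H (c + inverse (Suc n) * s)\<bar> \<le> M" if "s \<in> {0..1}" for s
    proof (rule M)
      have "inverse (Suc n) * s \<le> 1 * 1"
        using that by (intro mult_mono) (auto simp: inverse_eq_divide)
      then show "c + inverse (Suc n) * s \<in> {c..c+1}"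
        using that by simp
    qed
    then have "\<bar>\<beta> s\<bar> * \<bar>H (c + inverse (Suc n) * s)\<bar> \<le> \<bar>\<beta> s\<bar> * M" for s
      using \<beta>(2)[of s] by (cases "s \<in> {0..1}") (auto intro: mult_left_mono)
    then show "AE s in lborel. norm (\<beta> s * H (c + inverse (Suc n) * s)) \<le> M * \<bar>\<beta> s\<bar>"
      by (simp add: abs_mult mult.commute)
  qed auto
  then show ?thesis by simp
qed

text \<open>With \<open>G\<close> absorbed into \<open>F\<close> via an antiderivative, a test function that is the difference of two
  scaled smooth steps shows that the mollifications of \<open>F\<close> at any two points agree.\<close>

lemma has_distributional_derivative_imp_derivative:
  assumes F: "continuous_on {0..} F" and G: "continuous_on {0..} G"
    and FG: "has_distributional_derivative F G" and t: "t \<ge> 0"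
  shows "(F has_real_derivative G t) (at t within {0..})"
proof -
  \<comment> \<open>Freezing both functions at their value at 0 makes them continuous on the whole
    line; test functions live in positive time and cannot tell the difference.\<close>
  define Ft where "Ft s = F (max 0 s)" for s
  define Gt where "Gt s = G (max 0 s)" for s
  have cFt: "continuous_on UNIV Ft" unfolding Ft_def
    by (rule continuous_on_compose2[OF F]) (auto intro!: continuous_intros)
  have cGt: "continuous_on UNIV Gt" unfolding Gt_def
    by (rule continuous_on_compose2[OF G]) (auto intro!: continuous_intros)
  obtain A where A: "\<And>x. (A has_real_derivative Gt x) (at x)"
    using continuous_antiderivative_real[OF cGt] by blast
  have cA: "continuous_on UNIV A"
    using A DERIV_isCont continuous_at_imp_continuous_on by metis
  \<comment> \<open>H has distributional derivative 0 on positive times; the goal becomes that it is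
    constant on \<open>{0..}\<close>.\<close>
  define H where "H s = Ft s - A s" for s
  have cH: "continuous_on UNIV H"
    unfolding H_def by (intro continuous_intros cFt cA)
  obtain \<beta> where \<beta>: "elem_smooth \<beta>" "\<And>x. x \<notin> {0..1} \<Longrightarrow> \<beta> x = 0" "(LBINT x. \<beta> x) > 0"
    using smooth_bump by blast
  have c\<beta>: "continuous_on UNIV \<beta>" by (rule elem_smooth_continuous[OF \<beta>(1)])
  obtain B where B: "\<And>x. (B has_real_derivative \<beta> x) (at x)"
    using continuous_antiderivative_real[OF c\<beta>] by blast
  have smB: "elem_smooth B" by (rule elem_smooth.antiderivative[OF \<beta>(1) B])
  \<comment> \<open>The support condition says nothing about the endpoints; continuity does. With
    this, B is a smooth step, constant to the left of 0 and to the right of 1.\<close>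
  have \<beta>0: "\<beta> 0 = 0" "\<beta> 1 = 0"
  proof -
    have "isCont \<beta> 0" "isCont \<beta> 1" using c\<beta> by (auto simp: continuous_on_eq_continuous_at)
    moreover have "(\<beta> \<longlongrightarrow> 0) (at_left 0)" "(\<beta> \<longlongrightarrow> 0) (at_right 1)"
      by (rule tendsto_eventually, auto simp: \<beta>(2) intro!: eventually_at_leftI[of "-1"] eventually_at_rightI[of _ 2])+
    ultimately show "\<beta> 0 = 0" "\<beta> 1 = 0"
      by (metis isCont_def filterlim_at_split tendsto_unique trivial_limit_at_left_real,
          metis isCont_def filterlim_at_split tendsto_unique trivial_limit_at_right_real)
  qed
  have B0: "B x = B 0" if "x \<le> 0" for x
  proof (cases "x = 0")
    case False
    then have "(LBINT y. indicator {x..0} y *\<^sub>R \<beta> y) = B 0 - B x"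
      using that B by (intro integral_FTC_Icc) (auto intro: continuous_on_subset[OF c\<beta>]
          simp flip: has_real_derivative_iff_has_vector_derivative intro: has_field_derivative_at_within)
    moreover have "(\<lambda>y. indicator {x..0} y *\<^sub>R \<beta> y) = (\<lambda>y. 0)"
      using \<beta>(2) \<beta>0 by (force simp: indicator_def)
    ultimately show ?thesis by simp
  qed simp
  have B1: "B x = B 1" if "x \<ge> 1" for x
  proof (cases "x = 1")
    case False
    then have "(LBINT y. indicator {1..x} y *\<^sub>R \<beta> y) = B x - B 1"
      using that B by (intro integral_FTC_Icc) (auto intro: continuous_on_subset[OF c\<beta>]
          simp flip: has_real_derivative_iff_has_vector_derivative intro: has_field_derivative_at_within)
    moreover have "(\<lambda>y. indicator {1..x} y *\<^sub>R \<beta> y) = (\<lambda>y. 0)"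
      using \<beta>(2) \<beta>0 by (force simp: indicator_def)
    ultimately show ?thesis by simp
  qed simp
  have mol: "(LBINT s. \<beta> s * H (a + \<epsilon> * s)) = (LBINT s. \<beta> s * H (b + \<epsilon> * s))"
    if "0 < a" "a < b" "\<epsilon> > 0" for a b \<epsilon>
  proof -
    \<comment> \<open>Two steps of width \<epsilon>, starting at a and at b: they cancel before a
      and after b + \<epsilon>, so the difference has compact support in positive time. Its
      derivative is a bump of mass \<open>LBINT x. \<beta> x\<close> at a minus the same bump at b.
      The arguments are spelled in the shape of \<open>elem_smooth.affine\<close>.\<close>
    define \<phi> where "\<phi> t = B (inverse \<epsilon> * t + - a / \<epsilon>) + - 1 * B (inverse \<epsilon> * t + - b / \<epsilon>)" for t
    define \<beta>' where "\<beta>' c t = \<beta> (inverse \<epsilon> * t + - c / \<epsilon>) * inverse \<epsilon>" for c t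
    define \<phi>' where "\<phi>' t = \<beta>' a t - \<beta>' b t" for t
    have D: "(\<phi> has_real_derivative \<phi>' t) (at t)" for t
      unfolding \<phi>_def \<phi>'_def \<beta>'_def
      by (auto intro!: derivative_eq_intros DERIV_chain'[OF _ B])
    have zero: "\<phi> t = 0" if "t \<le> a \<or> t \<ge> b + \<epsilon>" for t
      using that
    proof
      assume "t \<le> a"
      then show ?thesis
        using B0[of "inverse \<epsilon> * t + - a / \<epsilon>"] B0[of "inverse \<epsilon> * t + - b / \<epsilon>"]
          \<open>a < b\<close> \<open>\<epsilon> > 0\<close> by (simp add: \<phi>_def field_simps)
    next
      assume "t \<ge> b + \<epsilon>"
      then show ?thesis
        using B1[of "inverse \<epsilon> * t + - a / \<epsilon>"] B1[of "inverse \<epsilon> * t + - b / \<epsilon>"]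
          \<open>a < b\<close> \<open>\<epsilon> > 0\<close> by (simp add: \<phi>_def field_simps)
    qed
    have supp: "\<phi> t = 0" if "t \<notin> {a..b + \<epsilon>}" for t
      using that by (intro zero) auto
    have ends: "\<phi> a = 0" "\<phi> (b + \<epsilon>) = 0"
      by (simp_all add: zero)
    have supp\<beta>: "\<beta>' c t = 0" if "t \<notin> {a..b + \<epsilon>}" "a \<le> c" "c \<le> b" for c t
    proof -
      have "inverse \<epsilon> * t + - c / \<epsilon> \<notin> {0..1}"
        using that \<open>\<epsilon> > 0\<close> by (auto simp: field_simps)
      then show ?thesis by (simp add: \<beta>'_def \<beta>(2))
    qed
    have c\<beta>': "continuous_on UNIV (\<beta>' c)" for c
      unfolding \<beta>'_def by (auto intro!: continuous_intros continuous_on_compose2[OF c\<beta>])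
    have c\<phi>: "continuous_on UNIV \<phi>"
      by (intro continuous_at_imp_continuous_on ballI DERIV_isCont[OF D])
    have c\<phi>': "continuous_on UNIV \<phi>'"
      unfolding \<phi>'_def[abs_def] by (intro continuous_intros c\<beta>')
    have deriv: "deriv \<phi> = \<phi>'" using D by (intro ext DERIV_imp_deriv)
    have "elem_smooth \<phi>"
      unfolding \<phi>_def by (intro elem_smooth.add elem_smooth.mult elem_smooth.affine[OF smB] elem_smooth.const)
    then have "time_test_function \<phi>"
      unfolding time_test_function_def
      using elem_smooth_differentiable[of \<phi>] supp \<open>0 < a\<close> by meson
    with FG have "(LINT t:{0<..}|lborel. \<phi>' t * F t) = - (LINT t:{0<..}|lborel. \<phi> t * G t)"
      unfolding has_distributional_derivative_def deriv[symmetric] by blast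
    moreover have "(LINT t:{0<..}|lborel. \<phi>' t * F t) = (LBINT t. \<phi>' t * Ft t)"
      unfolding set_lebesgue_integral_def \<phi>'_def using \<open>0 < a\<close> \<open>a < b\<close>
      by (intro Bochner_Integration.integral_cong) (auto simp: indicator_def Ft_def supp\<beta>)
    moreover have "(LINT t:{0<..}|lborel. \<phi> t * G t) = (LBINT t. \<phi> t * Gt t)"
      unfolding set_lebesgue_integral_def using \<open>0 < a\<close>
      by (intro Bochner_Integration.integral_cong) (auto simp: indicator_def Gt_def supp)
    ultimately have 1: "(LBINT t. \<phi>' t * Ft t) = - (LBINT t. \<phi> t * Gt t)" by simp
    have supp': "\<phi>' t = 0" if "t \<notin> {a..b + \<epsilon>}" for t
      using supp\<beta>[OF that] \<open>a < b\<close> by (simp add: \<phi>'_def)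
    have prod: "integrable lborel (\<lambda>t. p t * q t)"
      if "continuous_on UNIV p" "continuous_on UNIV q" "\<And>t. t \<notin> {a..b + \<epsilon>} \<Longrightarrow> p t = 0"
      for p q :: "real \<Rightarrow> real"
      by (rule integrable_lborel_compact_support[where a=a and b="b+\<epsilon>"])
         (simp_all add: that continuous_on_mult)
    note i = prod[OF c\<phi>' cFt supp'] prod[OF c\<phi> cGt supp] prod[OF c\<phi>' cA supp']
    have i\<beta>: "integrable lborel (\<lambda>t. \<beta>' c t * H t)" if "a \<le> c" "c \<le> b" for c
      by (rule prod[OF c\<beta>' cH supp\<beta>[OF _ that]])
    \<comment> \<open>Integration by parts without boundary terms turns the integral of \<phi>
      against G into minus that of \<phi>' against A; together with the weak equation, \<phi>'
      integrates to 0 against H.\<close>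
    have "(LBINT t. \<phi>' t * A t + \<phi> t * Gt t) = \<phi> (b + \<epsilon>) * A (b + \<epsilon>) - \<phi> a * A a"
    proof (rule integral_derivative_compact_support[where g="\<lambda>t. \<phi> t * A t"])
      show "((\<lambda>t. \<phi> t * A t) has_real_derivative \<phi>' x * A x + \<phi> x * Gt x) (at x)" for x
        using DERIV_mult[OF D A, of x] by (simp add: mult.commute)
      show "continuous_on UNIV (\<lambda>t. \<phi>' t * A t + \<phi> t * Gt t)"
        by (intro continuous_intros c\<phi> c\<phi>' cA cGt)
    qed (use \<open>a < b\<close> \<open>\<epsilon> > 0\<close> supp supp' in auto)
    with ends i 1 have "(LBINT t. \<phi>' t * Ft t) - (LBINT t. \<phi>' t * A t) = 0" by simp
    then have "(LBINT t. \<phi>' t * Ft t - \<phi>' t * A t) = 0" using i by simp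
    moreover have "\<phi>' t * Ft t - \<phi>' t * A t = \<beta>' a t * H t - \<beta>' b t * H t" for t
      by (simp add: \<phi>'_def H_def algebra_simps)
    ultimately have "(LBINT t. \<beta>' a t * H t) = (LBINT t. \<beta>' b t * H t)"
      using i\<beta>[of a] i\<beta>[of b] \<open>a < b\<close> by simp
    moreover have "(LBINT t. \<beta>' c t * H t) = (LBINT s. \<beta> s * H (c + \<epsilon> * s))" for c
    proof -
      \<comment> \<open>Substituting t = c + \<epsilon> s produces a Jacobian \<epsilon> that
        cancels the normalisation of \<open>\<beta>'\<close>.\<close>
      have "(LBINT t. \<beta>' c t * H t) = \<epsilon> * (LBINT s. \<beta>' c (c + \<epsilon> * s) * H (c + \<epsilon> * s))"
        using lborel_integral_real_affine[of \<epsilon> "\<lambda>t. \<beta>' c t * H t" c] \<open>\<epsilon> > 0\<close> by simp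
      also have "\<dots> = (LBINT s. \<epsilon> * (\<beta>' c (c + \<epsilon> * s) * H (c + \<epsilon> * s)))" by simp
      also have "\<dots> = (LBINT s. \<beta> s * H (c + \<epsilon> * s))"
      proof (rule Bochner_Integration.integral_cong)
        fix s
        have "inverse \<epsilon> * (c + \<epsilon> * s) + - c / \<epsilon> = s"
          using \<open>\<epsilon> > 0\<close> by (simp add: field_simps)
        then show "\<epsilon> * (\<beta>' c (c + \<epsilon> * s) * H (c + \<epsilon> * s)) = \<beta> s * H (c + \<epsilon> * s)"
          using \<open>\<epsilon> > 0\<close> by (simp add: \<beta>'_def)
      qed simp
      finally show ?thesis .
    qed
    ultimately show ?thesis by simp
  qed
  have Heq: "H a = H b" if "0 < a" "a < b" for a b
  proof -
    have "(\<lambda>n. LBINT s. \<beta> s * H (a + inverse (Suc n) * s)) \<longlonglongrightarrow> (LBINT s. \<beta> s) * H a"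
      by (rule mollifier_tendsto[OF cH c\<beta> \<beta>(2)])
    moreover have "(\<lambda>n. LBINT s. \<beta> s * H (a + inverse (Suc n) * s)) \<longlonglongrightarrow> (LBINT s. \<beta> s) * H b"
      using mollifier_tendsto[OF cH c\<beta> \<beta>(2), of b] mol[OF that, of "inverse (Suc n)" for n] by simp
    ultimately show ?thesis using \<beta>(3) by (auto dest: LIMSEQ_unique)
  qed
  have H0: "H s = H 0" if "s \<ge> 0" for s
  proof (cases "s = 0")
    case False
    \<comment> \<open>So far H is constant on positive times only. The sequence s/(n+1) stays there
      and tends to 0, which carries the value to time 0.\<close>
    have "(\<lambda>n. H (s * inverse (Suc n))) \<longlonglongrightarrow> H (s * 0)"
      using cH by (intro isCont_tendsto_compose[of _ H] tendsto_intros LIMSEQ_inverse_real_of_nat)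
        (auto simp: continuous_on_eq_continuous_at)
    moreover have "H (s * inverse (Suc n)) = H s" for n
    proof (cases "n = 0")
      case False
      have "0 < s" using \<open>s \<noteq> 0\<close> that by simp
      moreover have "inverse (real (Suc n)) < 1"
        using False by (intro inverse_less_1_iff[THEN iffD2]) simp
      ultimately show ?thesis
        using mult_strict_left_mono[of "inverse (real (Suc n))" 1 s] by (intro Heq) auto
    qed simp
    ultimately show ?thesis by (simp add: LIMSEQ_const_iff)
  qed simp
  have "((\<lambda>s. H 0 + A s) has_real_derivative 0 + Gt t) (at t within {0..})"
    by (intro DERIV_add DERIV_const has_field_derivative_at_within[OF A])
  then have "((\<lambda>s. H 0 + A s) has_real_derivative G t) (at t within {0..})"
    using t by (simp add: Gt_def)
  moreover have "F s = H 0 + A s" if "s \<in> {0..}" for s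
    using H0[of s] that by (simp add: H_def Ft_def)
  ultimately show ?thesis
    using has_field_derivative_transform_within[of "\<lambda>s. H 0 + A s" "G t" t "{0..}" 1 F] t by simp
qed

section \<open>Smooth dependence of the attention head on its parameter\<close>

lemma GDERIV_unique: "GDERIV f x :> d \<Longrightarrow> GDERIV f x :> d' \<Longrightarrow> d = d'"
  unfolding gderiv_def using has_derivative_unique[of f "\<lambda>h. h \<bullet> d" x "\<lambda>h. h \<bullet> d'"]
  by (metis inner_commute vector_eq_ldot)

lemma grad_eqI: "GDERIV f x :> d \<Longrightarrow> grad f x = d"
  unfolding grad_def using GDERIV_unique by blast

text \<open>The gradient is taken in the parameter alone, but continuity is required jointly: this
  yields bounds uniform over compact sets of pairs and measurability on product spaces, as Fubini
  needs.\<close>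

definition param_C1 :: "('x::topological_space \<Rightarrow> 'w::real_inner \<Rightarrow> real) \<Rightarrow> bool" where
  "param_C1 q \<longleftrightarrow> continuous_on UNIV (\<lambda>(x, w). q x w) \<and>
     continuous_on UNIV (\<lambda>(x, w). grad (q x) w) \<and> (\<forall>x w. GDERIV (q x) w :> grad (q x) w)"

lemma param_C1I:
  assumes "continuous_on UNIV (\<lambda>(x, w). q x w)" "continuous_on UNIV (\<lambda>(x, w). Q x w)"
    and "\<And>x w. GDERIV (q x) w :> Q x w"
  shows "param_C1 q"
proof -
  have "grad (q x) w = Q x w" for x w by (rule grad_eqI[OF assms(3)])
  with assms show ?thesis by (simp add: param_C1_def)
qed

lemma param_C1D:
  assumes "param_C1 q"
  shows "continuous_on UNIV (\<lambda>z. q (fst z) (snd z))"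
    "continuous_on UNIV (\<lambda>z. grad (q (fst z)) (snd z))"
    "GDERIV (q x) w :> grad (q x) w"
  using assms by (simp_all add: param_C1_def case_prod_beta)

lemma param_C1_fst:
  assumes "continuous_on UNIV c"
  shows "param_C1 (\<lambda>x w. c x)"
proof (rule param_C1I[where Q="\<lambda>x w. 0"])
  show "continuous_on UNIV (\<lambda>(x, w). c x)"
    unfolding case_prod_beta by (rule continuous_on_compose2[OF assms]) (auto intro: continuous_on_fst)
qed (auto intro: GDERIV_const)

lemma param_C1_const: "param_C1 (\<lambda>x w. c)"
  by (rule param_C1_fst) simp

text \<open>The gradient of a linear functional is its Riesz vector, here
  \<open>adjoint f 1\<close>.\<close>

lemma param_C1_linear:
  fixes f :: "'w::euclidean_space \<Rightarrow> real"
  assumes "bounded_linear f"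
  shows "param_C1 (\<lambda>x. f)"
proof (rule param_C1I[where Q="\<lambda>x w. adjoint f 1"])
  show "continuous_on UNIV (\<lambda>(x, w). f w)"
    unfolding case_prod_beta by (intro bounded_linear.continuous_on[OF assms] continuous_intros)
  show "GDERIV f w :> adjoint f 1" for w
  proof -
    have "h \<bullet> adjoint f 1 = f h" for h
      using adjoint_works[OF bounded_linear.linear[OF assms], of h 1] by simp
    then show ?thesis
      using bounded_linear_imp_has_derivative[OF assms] by (simp add: gderiv_def)
  qed
qed simp

lemma param_C1_add:
  assumes "param_C1 p" "param_C1 q"
  shows "param_C1 (\<lambda>x w. p x w + q x w)"
proof (rule param_C1I[where Q="\<lambda>x w. grad (p x) w + grad (q x) w"])
  show "continuous_on UNIV (\<lambda>(x, w). p x w + q x w)"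
    unfolding case_prod_beta by (intro continuous_intros param_C1D assms)
  show "continuous_on UNIV (\<lambda>(x, w). grad (p x) w + grad (q x) w)"
    unfolding case_prod_beta by (intro continuous_intros param_C1D assms)
  show "GDERIV (\<lambda>w. p x w + q x w) w :> grad (p x) w + grad (q x) w" for x w
    by (intro GDERIV_add param_C1D assms)
qed

lemma param_C1_mult:
  assumes "param_C1 p" "param_C1 q"
  shows "param_C1 (\<lambda>x w. p x w * q x w)"
proof (rule param_C1I[where Q="\<lambda>x w. p x w *\<^sub>R grad (q x) w + q x w *\<^sub>R grad (p x) w"])
  show "continuous_on UNIV (\<lambda>(x, w). p x w * q x w)"
    unfolding case_prod_beta by (intro continuous_intros param_C1D assms)
  show "continuous_on UNIV (\<lambda>(x, w). p x w *\<^sub>R grad (q x) w + q x w *\<^sub>R grad (p x) w)"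
    unfolding case_prod_beta by (intro continuous_intros param_C1D assms)
  show "GDERIV (\<lambda>w. p x w * q x w) w :> p x w *\<^sub>R grad (q x) w + q x w *\<^sub>R grad (p x) w" for x w
    by (intro GDERIV_mult param_C1D assms)
qed

lemma param_C1_exp:
  assumes "param_C1 p"
  shows "param_C1 (\<lambda>x w. exp (p x w))"
proof (rule param_C1I[where Q="\<lambda>x w. exp (p x w) *\<^sub>R grad (p x) w"])
  show "continuous_on UNIV (\<lambda>(x, w). exp (p x w))"
    unfolding case_prod_beta by (intro continuous_intros param_C1D assms)
  show "continuous_on UNIV (\<lambda>(x, w). exp (p x w) *\<^sub>R grad (p x) w)"
    unfolding case_prod_beta by (intro continuous_intros param_C1D assms)
  show "GDERIV (\<lambda>w. exp (p x w)) w :> exp (p x w) *\<^sub>R grad (p x) w" for x w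
    by (intro GDERIV_DERIV_compose[where g=exp] DERIV_exp param_C1D assms)
qed

lemma param_C1_inverse:
  assumes "param_C1 p" "\<And>x w. p x w \<noteq> 0"
  shows "param_C1 (\<lambda>x w. inverse (p x w))"
proof (rule param_C1I[where Q="\<lambda>x w. - (inverse (p x w))\<^sup>2 *\<^sub>R grad (p x) w"])
  show "continuous_on UNIV (\<lambda>(x, w). inverse (p x w))"
    unfolding case_prod_beta by (intro continuous_intros param_C1D assms) (simp_all add: assms)
  show "continuous_on UNIV (\<lambda>(x, w). - (inverse (p x w))\<^sup>2 *\<^sub>R grad (p x) w)"
    unfolding case_prod_beta by (intro continuous_intros param_C1D assms) (simp_all add: assms)
  show "GDERIV (\<lambda>w. inverse (p x w)) w :> - (inverse (p x w))\<^sup>2 *\<^sub>R grad (p x) w" for x w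
    by (intro GDERIV_inverse param_C1D assms)
qed

lemma param_C1_sum:
  assumes "\<And>i. i \<in> I \<Longrightarrow> param_C1 (p i)" shows "param_C1 (\<lambda>x w. \<Sum>i\<in>I. p i x w)"
  using assms by (induction I rule: infinite_finite_induct) (auto intro: param_C1_const param_C1_add)

lemma param_C1_matrix_mult:
  assumes "\<And>i k. param_C1 (\<lambda>x w. A x w $ i $ k)" "\<And>k j. param_C1 (\<lambda>x w. B x w $ k $ j)"
  shows "param_C1 (\<lambda>x w. (A x w ** B x w) $ i $ j)"
  unfolding matrix_matrix_mult_def using assms by (auto intro!: param_C1_sum param_C1_mult)

text \<open>Makes the coordinates of \<open>psi\<close> admissible in the weak equation. The
  derivative is the image of the gradient under the bounded linear map
  \<open>blinfun_inner_left\<close>, so it inherits continuity.\<close>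

lemma param_C1_imp_C1_on:
  fixes q :: "'x::topological_space \<Rightarrow> 'w::real_inner \<Rightarrow> real"
  assumes "param_C1 q"
  shows "C1_on K (q x)"
  unfolding C1_on_def
proof (intro exI[of _ UNIV] conjI)
  have D: "(q x has_derivative (\<lambda>h. h \<bullet> grad (q x) w)) (at w)" for w
    using assms by (simp add: param_C1_def gderiv_def)
  then show "q x differentiable_on UNIV"
    by (auto simp: differentiable_on_def differentiable_def)
  have "fderiv (q x) w = blinfun_inner_left (grad (q x) w)" for w
    unfolding fderiv_def frechet_derivative_at[OF D, symmetric]
    by (rule blinfun_eqI) (simp add: bounded_linear_Blinfun_apply bounded_linear_inner_left)
  then have "fderiv (q x) = (\<lambda>w. blinfun_inner_left (grad (q x) w))" by blast
  moreover have "continuous_on UNIV (\<lambda>w. grad (q x) w)"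
    using continuous_on_compose2[OF param_C1D(2)[OF assms], of UNIV "\<lambda>w. (x, w)"]
    by (simp add: continuous_on_Pair)
  ultimately show "continuous_on UNIV (fderiv (q x))"
    by (simp add: bounded_linear.continuous_on[OF bounded_linear_blinfun_inner_left])
qed auto

text \<open>Entries of the weights are linear in the head and entries of the input do not depend on
  it; everything else is sums, products, exponentials and division by the attention
  normaliser.\<close>

lemma param_C1_psi:
  fixes Wout :: "real^('dv::finite)^('dx::finite)" and l :: "'l::{finite,linorder}"
  shows "param_C1 (\<lambda>X (\<omega> :: ('dx, 'dk::finite) head). psi Wout l X \<omega> $ j)"
proof -
  note snd2 = bounded_linear_compose[OF bounded_linear_snd bounded_linear_snd]
  note lin = param_C1_linear bounded_linear_compose[OF bounded_linear_vec_nth]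
    bounded_linear_fst bounded_linear_compose[OF bounded_linear_fst bounded_linear_snd]
    bounded_linear_compose[OF bounded_linear_fst snd2]
    bounded_linear_compose[OF bounded_linear_snd snd2]
  have W: "param_C1 (\<lambda>(X::real^'dx^('l::{finite,linorder})) (\<omega> :: ('dx, 'dk) head). fst \<omega> $ i $ k)"
    "param_C1 (\<lambda>(X::real^'dx^('l::{finite,linorder})) (\<omega> :: ('dx, 'dk) head). fst (snd \<omega>) $ i $ k)"
    "param_C1 (\<lambda>(X::real^'dx^('l::{finite,linorder})) (\<omega> :: ('dx, 'dk) head). fst (snd (snd \<omega>)) $ i $ k)"
    "param_C1 (\<lambda>(X::real^'dx^('l::{finite,linorder})) (\<omega> :: ('dx, 'dk) head). snd (snd (snd \<omega>)) $ k $ i)" for i k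
    by (intro lin)+
  have X: "param_C1 (\<lambda>(X::real^'dx^('l::{finite,linorder})) (\<omega> :: ('dx, 'dk) head). X $ i $ k)" for i k
    by (intro param_C1_fst continuous_intros)
  have score: "param_C1 (\<lambda>X (\<omega> :: ('dx, 'dk) head). attn_score \<omega> X $ r $ s)" for r s :: "'l::{finite,linorder}"
    unfolding attn_score_def case_prod_beta
    using W X by (auto intro!: param_C1_matrix_mult simp: transpose_def)
  \<comment> \<open>The causal mask always leaves position r visible to itself, so the sum is not
    empty.\<close>
  have pos: "(\<Sum>s'\<in>{..r}. exp (u s')) \<noteq> (0::real)" for r :: "'l::{finite,linorder}" and u
    by (rule less_imp_neq[THEN not_sym], rule sum_pos) auto
  have att: "param_C1 (\<lambda>X (\<omega> :: ('dx, 'dk) head). attn \<omega> X $ r $ s)" for r s :: "'l::{finite,linorder}"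
    unfolding attn_def divide_inverse
    by (cases "s \<le> r") (simp_all add: param_C1_const param_C1_mult param_C1_exp param_C1_inverse param_C1_sum score pos)
  show ?thesis
    unfolding psi_def row_def case_prod_beta
    using W X att by (auto intro!: param_C1_matrix_mult param_C1_const)
qed

section \<open>Integrals with parameters and the cross entropy\<close>

text \<open>Differentiation under the integral relative to a convex set, so that one statement
  covers a ball in parameter space and the half-line of times. On a convex set the mean value
  inequality bounds the first-order remainder uniformly.\<close>

lemma (in finite_measure) has_derivative_integral_bounded:
  fixes f :: "'b::euclidean_space \<Rightarrow> 'a \<Rightarrow> real" and g :: "'b \<Rightarrow> 'a \<Rightarrow> 'b"
  assumes S: "convex S" "x \<in> S"
    and f: "\<And>y. y \<in> S \<Longrightarrow> integrable M (f y)"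
    and g: "g x \<in> borel_measurable M"
    and der: "AE X in M. \<forall>y\<in>S. ((\<lambda>y. f y X) has_derivative (\<lambda>h. h \<bullet> g y X)) (at y within S)"
    and C: "AE X in M. \<forall>y\<in>S. norm (g y X) \<le> C"
  shows "((\<lambda>y. \<integral>X. f y X \<partial>M) has_derivative (\<lambda>h. h \<bullet> (\<integral>X. g x X \<partial>M))) (at x within S)"
  unfolding has_derivative_within tendsto_at_iff_sequentially comp_def
proof (intro conjI allI impI bounded_linear_inner_left)
  fix Z assume Z: "\<forall>i. Z i \<in> S - {x}" "Z \<longlonglongrightarrow> x"
  have ig: "integrable M (g x)"
    by (rule integrable_const_bound[OF _ g]) (use C S in \<open>auto elim: eventually_mono\<close>)
  \<comment> \<open>The normalised remainder of the first-order expansion. It is dominated by 2 C: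
    one C for the increment of f, one for the linear term.\<close>
  define d where "d i X = (1 / norm (Z i - x)) *\<^sub>R (f (Z i) X - (f x X + (Z i - x) \<bullet> g x X))" for i X
  have id: "integrable M (d i)" for i
    unfolding d_def using Z(1) S f ig by (intro integrable_scaleR_right Bochner_Integration.integrable_diff
      Bochner_Integration.integrable_add integrable_inner_right) auto
  have "(\<lambda>i. \<integral>X. d i X \<partial>M) \<longlonglongrightarrow> (\<integral>X. 0 \<partial>M)"
  proof (rule integral_dominated_convergence)
    show "integrable M (\<lambda>X. 2 * C)" by simp
    show "AE X in M. (\<lambda>i. d i X) \<longlonglongrightarrow> 0"
      using der
    proof eventually_elim
      case (elim X)
      then have "((\<lambda>y. f y X) has_derivative (\<lambda>h. h \<bullet> g x X)) (at x within S)" using S by blast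
      then show ?case
        using Z unfolding has_derivative_within tendsto_at_iff_sequentially comp_def d_def by blast
    qed
    fix i
    show "AE X in M. norm (d i X) \<le> 2 * C"
      using der C
    proof eventually_elim
      case (elim X)
      have n: "norm (Z i - x) > 0" using Z(1) by auto
      have 1: "norm (f (Z i) X - f x X) \<le> C * norm (Z i - x)"
      proof (rule differentiable_bound[OF S(1)])
        show "((\<lambda>y. f y X) has_derivative (\<lambda>h. h \<bullet> g y X)) (at y within S)" if "y \<in> S" for y
          using elim that by blast
        show "onorm (\<lambda>h. h \<bullet> g y X) \<le> C" if "y \<in> S" for y
        proof (rule onorm_le)
          fix h
          have "norm (h \<bullet> g y X) \<le> norm h * norm (g y X)" by (simp add: Cauchy_Schwarz_ineq2)
          also have "\<dots> \<le> norm h * C" using elim that by (intro mult_left_mono) auto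
          finally show "norm (h \<bullet> g y X) \<le> C * norm h" by (simp add: mult.commute)
        qed
      qed (use Z S in auto)
      have "norm ((Z i - x) \<bullet> g x X) \<le> norm (Z i - x) * norm (g x X)" by (simp add: Cauchy_Schwarz_ineq2)
      also have "\<dots> \<le> norm (Z i - x) * C" using elim S by (intro mult_left_mono) auto
      finally have "norm (f (Z i) X - (f x X + (Z i - x) \<bullet> g x X)) \<le> 2 * C * norm (Z i - x)"
        using 1 by (simp add: mult.commute)
      then show ?case using n by (simp add: d_def field_simps)
    qed
  qed (use id in auto)
  moreover have "(\<integral>X. d i X \<partial>M) =
    (1 / norm (Z i - x)) *\<^sub>R ((\<integral>X. f (Z i) X \<partial>M) - ((\<integral>X. f x X \<partial>M) + (Z i - x) \<bullet> (\<integral>X. g x X \<partial>M)))" for i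
  proof -
    have "Z i \<in> S" using Z(1) by auto
    then show ?thesis
      using f S ig unfolding d_def by simp
  qed
  ultimately show "(\<lambda>i. (1 / norm (Z i - x)) *\<^sub>R
      ((\<integral>X. f (Z i) X \<partial>M) - ((\<integral>X. f x X \<partial>M) + (Z i - x) \<bullet> (\<integral>X. g x X \<partial>M)))) \<longlonglongrightarrow> 0"
    by simp
qed

text \<open>The exceptional set of the bound may depend on t, because continuity is tested along
  sequences.\<close>

lemma (in finite_measure) continuous_on_integral_bounded:
  fixes h :: "'b::metric_space \<Rightarrow> 'a \<Rightarrow> real"
  assumes "\<And>t. t \<in> S \<Longrightarrow> h t \<in> borel_measurable M"
    and "AE X in M. continuous_on S (\<lambda>t. h t X)"
    and "\<And>t. t \<in> S \<Longrightarrow> AE X in M. \<bar>h t X\<bar> \<le> C"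
  shows "continuous_on S (\<lambda>t. \<integral>X. h t X \<partial>M)"
  unfolding continuous_on_sequentially comp_def
proof safe
  fix Z t assume t: "t \<in> S" and Z: "\<forall>n. Z n \<in> S" "Z \<longlonglongrightarrow> t"
  show "(\<lambda>n. \<integral>X. h (Z n) X \<partial>M) \<longlonglongrightarrow> (\<integral>X. h t X \<partial>M)"
  proof (rule integral_dominated_convergence)
    show "AE X in M. (\<lambda>n. h (Z n) X) \<longlonglongrightarrow> h t X"
      using assms(2)
    proof eventually_elim
      case (elim X)
      then show ?case using t Z unfolding continuous_on_sequentially comp_def by blast
    qed
    show "integrable M (\<lambda>X. C)" by simp
  qed (use assms t Z in auto)
qed

lemma (in prob_space) norm_integral_le_const:
  fixes f :: "'a \<Rightarrow> 'b::{banach, second_countable_topology}"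
  assumes "f \<in> borel_measurable M" "AE x in M. norm (f x) \<le> C"
  shows "norm (\<integral>x. f x \<partial>M) \<le> C"
proof -
  have "norm (\<integral>x. f x \<partial>M) \<le> (\<integral>x. norm (f x) \<partial>M)"
    by (rule integral_norm_bound)
  also have "\<dots> \<le> C"
    by (rule integral_le_const[OF integrable_norm[OF integrable_const_bound[OF assms(2,1)]] assms(2)])
  finally show ?thesis .
qed

lemma borel_measurable_pair_continuous:
  fixes h :: "'a::second_countable_topology \<Rightarrow> 'b::second_countable_topology \<Rightarrow> 'c::topological_space"
  assumes "continuous_on UNIV (\<lambda>z. h (fst z) (snd z))" "sets M = sets borel" "sets N = sets borel"
  shows "(\<lambda>z. h (fst z) (snd z)) \<in> borel_measurable (M \<Otimes>\<^sub>M N)"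
proof -
  have "sets (M \<Otimes>\<^sub>M N) = sets borel"
    by (rule trans[OF sets_pair_measure_cong[OF assms(2,3)] arg_cong[where f=sets, OF borel_prod]])
  then show ?thesis
    using borel_measurable_continuous_onI[OF assms(1)] measurable_cong_sets by blast
qed

text \<open>Lets both sides of the weak equation be rewritten using facts about
  \<open>\<rho> t\<close> that are known only for nonnegative times.\<close>

lemma has_distributional_derivative_cong:
  assumes "has_distributional_derivative F G" "\<And>t. t > 0 \<Longrightarrow> F t = F' t" "\<And>t. t > 0 \<Longrightarrow> G t = G' t"
  shows "has_distributional_derivative F' G'"
proof -
  have "(LINT t:{0<..}|lborel. p t * F t) = (LINT t:{0<..}|lborel. p t * F' t)"
    "(LINT t:{0<..}|lborel. p t * G t) = (LINT t:{0<..}|lborel. p t * G' t)" for p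
    using assms(2,3) by (auto intro!: set_lebesgue_integral_cong)
  with assms(1) show ?thesis by (simp add: has_distributional_derivative_def)
qed

section \<open>Softmax and cross entropy: derivative and bounds\<close>

lemma softmax_nth: "softmax z $ j = exp (z $ j) / (\<Sum>m\<in>UNIV. exp (z $ m))"
  by (simp add: softmax_def)

lemma sum_exp_pos: "(\<Sum>m\<in>(UNIV :: 'n::finite set). exp (z m)) > (0::real)"
  by (rule sum_pos) auto

lemma softmax_bounds: "0 \<le> softmax z $ j" "softmax z $ j \<le> 1"
proof -
  have "exp (z $ j) \<le> (\<Sum>m\<in>UNIV. exp (z $ m))"
    by (rule member_le_sum) auto
  then show "0 \<le> softmax z $ j" "softmax z $ j \<le> 1"
    using sum_exp_pos[of "\<lambda>m. z $ m"] by (auto simp: softmax_nth divide_le_eq)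
qed

lemma abs_softmax_minus_one_hot: "one_hot y \<Longrightarrow> \<bar>softmax z $ j - y $ j\<bar> \<le> 1"
  using softmax_bounds[of z j] by (auto simp: one_hot_def axis_def)

lemma has_derivative_cross_entropy:
  assumes "\<And>j. ((\<lambda>s. z s $ j) has_real_derivative z' j) (at t within S)"
  shows "((\<lambda>s. cross_entropy y (z s)) has_real_derivative
           (\<Sum>j\<in>UNIV. (softmax (z t) $ j - y $ j) * z' j)) (at t within S)"
proof -
  note P = sum_exp_pos[of "\<lambda>m. z t $ m"]
  have "((\<lambda>s. \<Sum>j\<in>UNIV. exp (z s $ j)) has_real_derivative (\<Sum>j\<in>UNIV. exp (z t $ j) * z' j)) (at t within S)"
    by (intro DERIV_sum DERIV_chain'[OF assms DERIV_exp])
  from DERIV_chain'[OF this DERIV_ln[OF P]]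
  have "((\<lambda>s. ln (\<Sum>j\<in>UNIV. exp (z s $ j))) has_real_derivative
      inverse (\<Sum>j\<in>UNIV. exp (z t $ j)) * (\<Sum>j\<in>UNIV. exp (z t $ j) * z' j)) (at t within S)" .
  moreover have "((\<lambda>s. \<Sum>j\<in>UNIV. y $ j * z s $ j) has_real_derivative (\<Sum>j\<in>UNIV. y $ j * z' j)) (at t within S)"
    by (intro DERIV_sum DERIV_cmult assms)
  ultimately have "((\<lambda>s. ln (\<Sum>j\<in>UNIV. exp (z s $ j)) - (\<Sum>j\<in>UNIV. y $ j * z s $ j)) has_real_derivative
      inverse (\<Sum>j\<in>UNIV. exp (z t $ j)) * (\<Sum>j\<in>UNIV. exp (z t $ j) * z' j) - (\<Sum>j\<in>UNIV. y $ j * z' j))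
      (at t within S)"
    by (rule DERIV_diff)
  then show ?thesis
    by (simp add: cross_entropy_def inner_vec_def softmax_nth sum_distrib_left sum_subtractf
        right_diff_distrib divide_inverse mult_ac)
qed

text \<open>With s the sum of exponentials, ln s lies between the logit of the label and s itself.
  The bound is crude, but it serves only to make the loss integrable.\<close>

lemma abs_cross_entropy_le:
  fixes y z :: "real^'n::finite"
  assumes "one_hot y" "\<And>j. \<bar>z $ j\<bar> \<le> B"
  shows "\<bar>cross_entropy y z\<bar> \<le> real CARD('n) * exp B + 2 * B"
proof -
  obtain j where y: "y = axis j 1" using assms by (auto simp: one_hot_def)
  define s where "s = (\<Sum>m\<in>UNIV. exp (z $ m))"
  have "s > 0" unfolding s_def by (rule sum_exp_pos)
  have "exp (z $ j) \<le> s" unfolding s_def by (rule member_le_sum) auto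
  then have "z $ j \<le> ln s" using \<open>s > 0\<close> by (simp add: ln_ge_iff)
  moreover have "s \<le> (\<Sum>m\<in>(UNIV::'n set). exp B)"
    unfolding s_def using assms(2) by (intro sum_mono) (auto simp: abs_le_iff)
  moreover have "ln s \<le> s" using \<open>s > 0\<close> ln_le_minus_one[of s] by simp
  moreover have "cross_entropy y z = ln s - z $ j"
    by (simp add: cross_entropy_def y inner_axis' s_def)
  ultimately show ?thesis using assms(2)[of j] by simp
qed

text \<open>The average over positions costs nothing, so only the number of coordinates enters the
  constant. This is the origin of the factors \<open>real CARD('dv)\<close> in the bounds on
  averages of residual-weighted terms.\<close>

lemma norm_average_le:
  fixes v :: "'l::finite \<Rightarrow> 'n::finite \<Rightarrow> 'a::real_normed_vector"
  assumes "\<And>l j. norm (v l j) \<le> B" "\<And>l j. \<bar>c l j\<bar> \<le> 1"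
  shows "norm ((1 / real CARD('l)) *\<^sub>R (\<Sum>l\<in>UNIV. \<Sum>j\<in>UNIV. c l j *\<^sub>R v l j)) \<le> real CARD('n) * B"
proof -
  have B: "0 \<le> B" using assms(1) norm_ge_zero order_trans by blast
  have "norm (c l j *\<^sub>R v l j) \<le> B" for l j
    using mult_mono[OF assms(2)[of l j] assms(1)[of l j]] by simp
  then have "norm (\<Sum>l\<in>UNIV. \<Sum>j\<in>UNIV. c l j *\<^sub>R v l j) \<le> (\<Sum>l\<in>(UNIV::'l set). \<Sum>j\<in>(UNIV::'n set). B)"
    by (intro order_trans[OF norm_sum] sum_mono)
  then show ?thesis by (simp add: field_simps)
qed

section \<open>The gradient of the first variation\<close>

(* Spelled with vec because the notation for vectors would impose the sort finite on the index type. *)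
type_synonym ('dx, 'l) tokens = "((real, 'dx) vec, 'l) vec"

locale attention_data =
  fixes Wout :: "real^('dv::finite)^('dx::finite)"
    and D :: "(real^'dx^('l::{finite,linorder})) measure"
    and Y :: "'l \<Rightarrow> real^'dx^('l::{finite,linorder}) \<Rightarrow> real^'dv"
    and K :: "('dx, 'dk::finite) head set"
    and Kx :: "(real^'dx) set"
  assumes data: "data_model D Y"
    and compact_K: "compact K" and compact_Kx: "compact Kx"
    and AE_Kx: "AE X in D. \<forall>l. X $ l \<in> Kx"
begin

abbreviation q :: "'l \<Rightarrow> 'dv \<Rightarrow> ('dx, 'l) tokens \<Rightarrow> ('dx, 'dk) head \<Rightarrow> real" where
  "q l j X \<omega> \<equiv> psi Wout l X \<omega> $ j"

abbreviation dq :: "'l \<Rightarrow> 'dv \<Rightarrow> ('dx, 'l) tokens \<Rightarrow> ('dx, 'dk) head \<Rightarrow> ('dx, 'dk) head" where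
  "dq l j X \<equiv> grad (q l j X)"

abbreviation residual :: "('dx, 'dk) head measure \<Rightarrow> 'l \<Rightarrow> 'dv \<Rightarrow> ('dx, 'l) tokens \<Rightarrow> real" where
  "residual \<rho> l j X \<equiv> softmax (logits Wout \<rho> l X) $ j - Y l X $ j"

abbreviation XX :: "(('dx, 'l) tokens) set" where
  "XX \<equiv> {X. \<forall>l. X $ l \<in> Kx}"

sublocale D: prob_space D
  using data by (simp add: data_model_def)

lemma sets_D: "sets D = sets borel"
  using data by (simp add: data_model_def)

lemma compact_XX: "compact XX"
proof -
  have "XX = (\<Inter>l. (\<lambda>X. X $ l) -` Kx)" by auto
  moreover have "closed ((\<lambda>X::('dx, 'l) tokens. X $ l) -` Kx)" for l
    by (intro continuous_closed_vimage compact_imp_closed[OF compact_Kx])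
       (auto intro: continuous_intros)
  ultimately have "closed XX" by auto
  moreover have "bounded XX"
  proof -
    obtain C where C: "\<And>x. x \<in> Kx \<Longrightarrow> norm x \<le> C"
      using compact_imp_bounded[OF compact_Kx] by (auto simp: bounded_iff)
    have "norm X \<le> (\<Sum>l\<in>(UNIV::'l set). C)" if "X \<in> XX" for X
    proof -
      have "norm X \<le> (\<Sum>l\<in>UNIV. norm (X $ l))"
        unfolding norm_vec_def by (rule L2_set_le_sum) simp
      also have "\<dots> \<le> (\<Sum>l\<in>(UNIV::'l set). C)" using that C by (intro sum_mono) auto
      finally show ?thesis .
    qed
    then show ?thesis unfolding bounded_iff by blast
  qed
  ultimately show ?thesis by (simp add: compact_eq_bounded_closed)
qed

text \<open>A single continuous function, the sum of all absolute values and gradient norms, is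
  bounded on the compact product and dominates each of its terms.\<close>

lemma psi_bounded:
  assumes "compact A" "compact C"
  shows "\<exists>B. \<forall>X\<in>A. \<forall>\<omega>\<in>C. \<forall>l j. \<bar>q l j X \<omega>\<bar> \<le> B \<and> norm (dq l j X \<omega>) \<le> B"
proof -
  define h where "h z = (\<Sum>l\<in>UNIV. \<Sum>j\<in>UNIV. \<bar>q l j (fst z) (snd z)\<bar> + norm (dq l j (fst z) (snd z)))" for z
  have "continuous_on UNIV h"
    unfolding h_def by (intro continuous_on_sum continuous_on_add continuous_on_rabs
        continuous_on_norm param_C1D(1,2)[OF param_C1_psi])
  from continuous_on_subset[OF this subset_UNIV] have "bounded (h ` (A \<times> C))"
    by (intro compact_imp_bounded compact_continuous_image compact_Times assms)
  then obtain B where B: "\<And>z. z \<in> A \<times> C \<Longrightarrow> \<bar>h z\<bar> \<le> B"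
    by (auto simp: bounded_iff)
  have le: "\<bar>q l j X \<omega>\<bar> + norm (dq l j X \<omega>) \<le> h (X, \<omega>)" for l j X \<omega>
  proof -
    have "\<bar>q l j X \<omega>\<bar> + norm (dq l j X \<omega>) \<le> (\<Sum>j\<in>UNIV. \<bar>q l j X \<omega>\<bar> + norm (dq l j X \<omega>))"
      by (rule member_le_sum[where f="\<lambda>j. \<bar>q l j X \<omega>\<bar> + norm (dq l j X \<omega>)"]) auto
    also have "\<dots> \<le> h (X, \<omega>)"
      unfolding h_def fst_conv snd_conv
      by (rule member_le_sum[where f="\<lambda>l. \<Sum>j\<in>UNIV. \<bar>q l j X \<omega>\<bar> + norm (dq l j X \<omega>)"])
         (auto intro: sum_nonneg)
    finally show ?thesis .
  qed
  show ?thesis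
  proof (intro exI[of _ B] conjI ballI allI)
    fix X \<omega> l j assume "X \<in> A" "\<omega> \<in> C"
    then have "h (X, \<omega>) \<le> B" using B[of "(X, \<omega>)"] by auto
    with le[of l X \<omega> j] show "\<bar>q l j X \<omega>\<bar> \<le> B" "norm (dq l j X \<omega>) \<le> B"
      using norm_ge_zero[of "dq l j X \<omega>"] abs_ge_zero[of "q l j X \<omega>"] by linarith+
  qed
qed

section \<open>Measurability and size of logits and residuals\<close>

lemma prob_measures_onD:
  assumes "\<rho> \<in> prob_measures_on K"
  shows "prob_space \<rho>" "sets \<rho> = sets borel" "AE \<omega> in \<rho>. \<omega> \<in> K"
  using assms by (auto simp: prob_measures_on_def)

lemma measurable_section:
  assumes "continuous_on UNIV (\<lambda>z. h (fst z) (snd z))" "sets \<rho> = sets borel"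
  shows "h X \<in> borel_measurable \<rho>"
proof -
  have "continuous_on UNIV (h X)"
    using continuous_on_compose2[OF assms(1), of UNIV "\<lambda>w. (X, w)"] by (simp add: continuous_on_Pair)
  then show ?thesis
    using borel_measurable_continuous_onI measurable_cong_sets[OF assms(2) refl] by blast
qed

lemma q_measurable: "sets \<rho> = sets borel \<Longrightarrow> q l j X \<in> borel_measurable \<rho>"
  using measurable_section[OF param_C1D(1)[OF param_C1_psi[of Wout l j]]] .

lemma dq_measurable: "sets \<rho> = sets borel \<Longrightarrow> dq l j X \<in> borel_measurable \<rho>"
  using measurable_section[OF param_C1D(2)[OF param_C1_psi[of Wout l j]]] .

lemma q_integrable:
  assumes "\<rho> \<in> prob_measures_on K"
  shows "integrable \<rho> (q l j X)"
proof -
  interpret prob_space \<rho> by (rule prob_measures_onD[OF assms])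
  obtain B where B: "\<forall>Z\<in>{X}. \<forall>\<omega>\<in>K. \<forall>l j. \<bar>q l j Z \<omega>\<bar> \<le> B \<and> norm (dq l j Z \<omega>) \<le> B"
    using psi_bounded[OF finite_imp_compact compact_K, of "{X}"] by blast
  show ?thesis
    by (rule integrable_const_bound[where B=B])
       (use prob_measures_onD[OF assms] B in \<open>auto elim!: eventually_mono intro: q_measurable\<close>)
qed

text \<open>Taking a coordinate commutes with the Bochner integral once the vector-valued integrand
  is known to be integrable, which follows from its expansion in coordinates.\<close>

lemma logits_nth:
  assumes "\<rho> \<in> prob_measures_on K"
  shows "logits Wout \<rho> l X $ j = (\<integral>\<omega>. q l j X \<omega> \<partial>\<rho>)"
proof -
  have "integrable \<rho> (psi Wout l X)"
  proof -
    have "integrable \<rho> (\<lambda>\<omega>. \<Sum>j\<in>UNIV. q l j X \<omega> *\<^sub>R axis j 1)"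
      by (intro Bochner_Integration.integrable_sum integrable_scaleR_left q_integrable assms)
    also have "(\<lambda>\<omega>. \<Sum>j\<in>UNIV. q l j X \<omega> *\<^sub>R axis j 1) = psi Wout l X"
      using basis_expansion[of "psi Wout l X \<omega>" for \<omega>] by (intro ext) (simp add: scalar_mult_eq_scaleR)
    finally show ?thesis .
  qed
  then show ?thesis
    unfolding logits_def by (intro integral_bounded_linear[symmetric] bounded_linear_vec_nth)
qed

lemma logits_nth_measurable:
  assumes "\<rho> \<in> prob_measures_on K"
  shows "(\<lambda>X. logits Wout \<rho> l X $ j) \<in> borel_measurable D"
proof -
  interpret prob_space \<rho> by (rule prob_measures_onD[OF assms])
  show ?thesis
    unfolding logits_nth[OF assms]
    by (rule borel_measurable_lebesgue_integral)
       (use borel_measurable_pair_continuous[OF param_C1D(1)[OF param_C1_psi[of Wout l j]] sets_D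
          prob_measures_onD(2)[OF assms]] in \<open>simp add: case_prod_beta'\<close>)
qed

lemma Y_measurable: "(\<lambda>X. Y l X $ j) \<in> borel_measurable D"
proof -
  have "Y l \<in> borel_measurable D"
    using data measurable_cong_sets[OF sets_D refl] by (auto simp: data_model_def)
  then show ?thesis
    by (rule measurable_compose) (intro borel_measurable_continuous_onI continuous_intros)
qed

lemma residual_measurable:
  assumes "\<rho> \<in> prob_measures_on K"
  shows "residual \<rho> l j \<in> borel_measurable D"
  unfolding softmax_nth
  by (intro borel_measurable_diff borel_measurable_divide borel_measurable_sum Y_measurable
      borel_measurable_exp logits_nth_measurable[OF assms]
      measurable_compose[OF logits_nth_measurable[OF assms] borel_measurable_exp])

lemma abs_residual_le: "\<bar>residual \<rho> l j X\<bar> \<le> 1"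
  using data by (intro abs_softmax_minus_one_hot) (auto simp: data_model_def)

lemma abs_logits_le:
  assumes "\<rho> \<in> prob_measures_on K" "\<And>\<omega>. \<omega> \<in> K \<Longrightarrow> \<bar>q l j X \<omega>\<bar> \<le> B"
  shows "\<bar>logits Wout \<rho> l X $ j\<bar> \<le> B"
proof -
  interpret prob_space \<rho> by (rule prob_measures_onD[OF assms(1)])
  have "AE \<omega> in \<rho>. q l j X \<omega> \<le> B" "AE \<omega> in \<rho>. - B \<le> q l j X \<omega>"
    using prob_measures_onD(3)[OF assms(1)] by (auto elim!: eventually_mono dest!: assms(2))
  then show ?thesis
    unfolding logits_nth[OF assms(1)]
    using integral_le_const[OF q_integrable[OF assms(1)]] integral_ge_const[OF q_integrable[OF assms(1)]]
    by (simp add: abs_le_iff minus_le_iff)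
qed

text \<open>The gradient of the first variation with the differentiation already moved inside the
  expectation. Unlike the definite description \<open>grad\<close>, the integral makes measurability
  and bounds visible.\<close>

definition grad_variation :: "('dx, 'dk) head measure \<Rightarrow> ('dx, 'dk) head \<Rightarrow> ('dx, 'dk) head" where
  "grad_variation \<rho> \<omega> =
     (LINT X|D. (1 / real CARD('l)) *\<^sub>R (\<Sum>l\<in>UNIV. \<Sum>j\<in>UNIV. residual \<rho> l j X *\<^sub>R dq l j X \<omega>))"

lemma AE_average_bound:
  fixes v :: "'l \<Rightarrow> 'dv \<Rightarrow> ('dx, 'l) tokens \<Rightarrow> 'b::real_normed_vector"
  assumes "\<And>l j X. X \<in> XX \<Longrightarrow> norm (v l j X) \<le> B"
  shows "AE X in D. norm ((1 / real CARD('l)) *\<^sub>R (\<Sum>l\<in>UNIV. \<Sum>j\<in>UNIV. residual \<rho> l j X *\<^sub>R v l j X))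
           \<le> real CARD('dv) * B"
  using AE_Kx
proof eventually_elim
  case (elim X)
  then show ?case
    by (intro norm_average_le abs_residual_le assms) simp
qed

lemma average_measurable:
  fixes v :: "'l \<Rightarrow> 'dv \<Rightarrow> ('dx, 'l) tokens \<Rightarrow> 'b::{real_normed_vector, second_countable_topology}"
  assumes "\<rho> \<in> prob_measures_on K" "\<And>l j. v l j \<in> borel_measurable D"
  shows "(\<lambda>X. (1 / real CARD('l)) *\<^sub>R (\<Sum>l\<in>UNIV. \<Sum>j\<in>UNIV. residual \<rho> l j X *\<^sub>R v l j X)) \<in> borel_measurable D"
  by (intro borel_measurable_scaleR borel_measurable_const borel_measurable_sum
      residual_measurable[OF assms(1)] assms(2))

lemma section_fst_measurable:
  assumes "continuous_on UNIV (\<lambda>z. h (fst z) (snd z))"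
  shows "(\<lambda>X. h X \<omega>) \<in> borel_measurable D"
proof -
  have "continuous_on UNIV (\<lambda>X. h X \<omega>)"
    using continuous_on_compose2[OF assms(1), of UNIV "\<lambda>X. (X, \<omega>)"] by (simp add: continuous_on_Pair)
  then show ?thesis
    using borel_measurable_continuous_onI measurable_cong_sets[OF sets_D refl] by blast
qed

lemma GDERIV_first_variation:
  assumes "\<rho> \<in> prob_measures_on K"
  shows "GDERIV (first_variation Wout D Y \<rho>) \<omega> :> grad_variation \<rho> \<omega>"
proof -
  \<comment> \<open>The closed unit ball is convex, compact and has \<omega> in its interior: it
    carries uniform bounds, and derivatives within it at \<omega> are full ones. Thus \<omega> need
    not lie in K.\<close>
  obtain B where *: "\<forall>X\<in>XX. \<forall>\<omega>'\<in>cball \<omega> 1. \<forall>l j. \<bar>q l j X \<omega>'\<bar> \<le> B \<and> norm (dq l j X \<omega>') \<le> B"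
    using psi_bounded[OF compact_XX compact_cball[of \<omega> 1]] by blast
  then have B: "\<And>l j X \<omega>'. X \<in> XX \<Longrightarrow> \<omega>' \<in> cball \<omega> 1 \<Longrightarrow> \<bar>q l j X \<omega>'\<bar> \<le> B"
    "\<And>l j X \<omega>'. X \<in> XX \<Longrightarrow> \<omega>' \<in> cball \<omega> 1 \<Longrightarrow> norm (dq l j X \<omega>') \<le> B"
    by blast+
  define f where "f \<omega>' X = (1 / real CARD('l)) *\<^sub>R (\<Sum>l\<in>UNIV. \<Sum>j\<in>UNIV. residual \<rho> l j X *\<^sub>R q l j X \<omega>')" for \<omega>' X
  define g where "g \<omega>' X = (1 / real CARD('l)) *\<^sub>R (\<Sum>l\<in>UNIV. \<Sum>j\<in>UNIV. residual \<rho> l j X *\<^sub>R dq l j X \<omega>')" for \<omega>' X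
  have "((\<lambda>\<omega>'. \<integral>X. f \<omega>' X \<partial>D) has_derivative (\<lambda>h. h \<bullet> (\<integral>X. g \<omega> X \<partial>D))) (at \<omega> within cball \<omega> 1)"
  proof (rule D.has_derivative_integral_bounded)
    show "integrable D (f \<omega>')" if "\<omega>' \<in> cball \<omega> 1" for \<omega>'
    proof (rule D.integrable_const_bound)
      show "AE X in D. norm (f \<omega>' X) \<le> real CARD('dv) * B"
        unfolding f_def using B that by (intro AE_average_bound) auto
      show "f \<omega>' \<in> borel_measurable D"
        unfolding f_def
        by (intro average_measurable assms section_fst_measurable param_C1D(1)[OF param_C1_psi])
    qed
    show "g \<omega> \<in> borel_measurable D"
      unfolding g_def
      by (intro average_measurable assms section_fst_measurable param_C1D(2)[OF param_C1_psi])
    show "AE X in D. \<forall>y\<in>cball \<omega> 1. norm (g y X) \<le> real CARD('dv) * B"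
      using AE_Kx
    proof eventually_elim
      case (elim X)
      then show ?case
        unfolding g_def by (intro ballI norm_average_le abs_residual_le B) simp_all
    qed
    show "AE X in D. \<forall>y\<in>cball \<omega> 1. ((\<lambda>y. f y X) has_derivative (\<lambda>h. h \<bullet> g y X)) (at y within cball \<omega> 1)"
    proof (intro AE_I2 ballI)
      fix X y
      have "(q l j X has_derivative (\<lambda>h. h \<bullet> dq l j X y)) (at y within cball \<omega> 1)" for l j
        using param_C1D(3)[OF param_C1_psi[of Wout l j], of X y]
        by (auto simp: gderiv_def intro: has_derivative_at_withinI)
      then have "((\<lambda>y. f y X) has_derivative
          (\<lambda>h. (1 / real CARD('l)) *\<^sub>R (\<Sum>l\<in>UNIV. \<Sum>j\<in>UNIV. residual \<rho> l j X *\<^sub>R (h \<bullet> dq l j X y)))) (at y within cball \<omega> 1)"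
        unfolding f_def by (intro has_derivative_scaleR_right has_derivative_sum)
      then show "((\<lambda>y. f y X) has_derivative (\<lambda>h. h \<bullet> g y X)) (at y within cball \<omega> 1)"
        by (simp add: g_def inner_sum_right)
    qed
  qed auto
  moreover have "first_variation Wout D Y \<rho> = (\<lambda>\<omega>'. \<integral>X. f \<omega>' X \<partial>D)"
    by (simp add: fun_eq_iff first_variation_def f_def inner_vec_def)
  moreover have "at \<omega> within cball \<omega> 1 = at \<omega>"
    by (rule at_within_interior) simp
  ultimately show ?thesis
    by (simp add: gderiv_def grad_variation_def g_def)
qed

lemma grad_first_variation:
  "\<rho> \<in> prob_measures_on K \<Longrightarrow> grad (first_variation Wout D Y \<rho>) \<omega> = grad_variation \<rho> \<omega>"
  by (rule grad_eqI[OF GDERIV_first_variation])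

lemma grad_variation_measurable:
  assumes "\<sigma> \<in> prob_measures_on K" "sets \<rho> = sets borel"
  shows "grad_variation \<sigma> \<in> borel_measurable \<rho>"
proof -
  have dq: "(\<lambda>z. dq l j (snd z) (fst z)) \<in> borel_measurable (\<rho> \<Otimes>\<^sub>M D)" for l j
    using measurable_compose[OF measurable_pair_swap'
        borel_measurable_pair_continuous[OF param_C1D(2)[OF param_C1_psi[of Wout l j]] sets_D assms(2)]]
    by (simp add: case_prod_beta')
  have res: "(\<lambda>z. residual \<sigma> l j (snd z)) \<in> borel_measurable (\<rho> \<Otimes>\<^sub>M D)" for l j
    by (rule measurable_compose[OF measurable_snd residual_measurable[OF assms(1)]])
  show ?thesis
    unfolding grad_variation_def[abs_def]
  proof (rule D.borel_measurable_lebesgue_integral)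
    show "(\<lambda>(\<omega>, X). (1 / real CARD('l)) *\<^sub>R (\<Sum>l\<in>UNIV. \<Sum>j\<in>UNIV. residual \<sigma> l j X *\<^sub>R dq l j X \<omega>))
        \<in> borel_measurable (\<rho> \<Otimes>\<^sub>M D)"
      unfolding case_prod_beta'
      by (intro borel_measurable_scaleR borel_measurable_const borel_measurable_sum dq res)
  qed
qed

lemma norm_grad_variation_le:
  assumes "\<And>l j X. X \<in> XX \<Longrightarrow> norm (dq l j X \<omega>) \<le> B" "\<sigma> \<in> prob_measures_on K"
  shows "norm (grad_variation \<sigma> \<omega>) \<le> real CARD('dv) * B"
  unfolding grad_variation_def
  by (intro D.norm_integral_le_const AE_average_bound average_measurable section_fst_measurable
      param_C1D(2)[OF param_C1_psi] assms)

lemma integral_inner_dq_measurable: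
  assumes \<rho>: "\<rho> \<in> prob_measures_on K" and g: "g \<in> borel_measurable \<rho>"
  shows "(\<lambda>X. LINT \<omega>|\<rho>. g \<omega> \<bullet> dq l j X \<omega>) \<in> borel_measurable D"
proof -
  interpret prob_space \<rho> by (rule prob_measures_onD[OF \<rho>])
  show ?thesis
  proof (rule borel_measurable_lebesgue_integral)
    show "(\<lambda>(X, \<omega>). g \<omega> \<bullet> dq l j X \<omega>) \<in> borel_measurable (D \<Otimes>\<^sub>M \<rho>)"
      unfolding case_prod_beta'
      by (intro borel_measurable_inner measurable_compose[OF measurable_snd g]
          borel_measurable_pair_continuous[OF param_C1D(2)[OF param_C1_psi] sets_D prob_measures_onD(2)[OF \<rho>]])
  qed
qed

text \<open>The exchange of parameter and input integrals. With g a gradient \<open>dq l j X\<close>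
  it gives continuity of the logit velocity in time; with g the gradient
  \<open>grad_variation\<close> itself it produces the dissipation.\<close>

lemma integral_inner_grad_variation:
  fixes g :: "('dx, 'dk) head \<Rightarrow> ('dx, 'dk) head"
  assumes \<rho>: "\<rho> \<in> prob_measures_on K" and \<sigma>: "\<sigma> \<in> prob_measures_on K"
    and g: "g \<in> borel_measurable \<rho>" "\<And>\<omega>. \<omega> \<in> K \<Longrightarrow> norm (g \<omega>) \<le> C"
  shows "(LINT \<omega>|\<rho>. g \<omega> \<bullet> grad_variation \<sigma> \<omega>) =
    (LINT X|D. (1 / real CARD('l)) * (\<Sum>l\<in>UNIV. \<Sum>j\<in>UNIV. residual \<sigma> l j X * (LINT \<omega>|\<rho>. g \<omega> \<bullet> dq l j X \<omega>)))"
proof -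
  interpret \<rho>: prob_space \<rho> by (rule prob_measures_onD[OF \<rho>])
  interpret P: pair_prob_space D \<rho> ..
  note sets_\<rho> = prob_measures_onD(2)[OF \<rho>]
  obtain B where *: "\<forall>X\<in>XX. \<forall>\<omega>\<in>K. \<forall>l j. \<bar>q l j X \<omega>\<bar> \<le> B \<and> norm (dq l j X \<omega>) \<le> B"
    using psi_bounded[OF compact_XX compact_K] by blast
  then have B: "\<And>l j X \<omega>. X \<in> XX \<Longrightarrow> \<omega> \<in> K \<Longrightarrow> norm (dq l j X \<omega>) \<le> B" by blast
  have gdq: "\<bar>g \<omega> \<bullet> dq l j X \<omega>\<bar> \<le> C * B" if "X \<in> XX" "\<omega> \<in> K" for l j X \<omega>
  proof -
    have "\<bar>g \<omega> \<bullet> dq l j X \<omega>\<bar> \<le> norm (g \<omega>) * norm (dq l j X \<omega>)" by (rule Cauchy_Schwarz_ineq2)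
    also have "\<dots> \<le> C * B"
      using order_trans[OF norm_ge_zero g(2)[OF that(2)]] by (intro mult_mono g(2) B that) auto
    finally show ?thesis .
  qed
  define F where "F X \<omega> = (1 / real CARD('l)) *\<^sub>R (\<Sum>l\<in>UNIV. \<Sum>j\<in>UNIV. residual \<sigma> l j X *\<^sub>R (g \<omega> \<bullet> dq l j X \<omega>))" for X \<omega>
  have F_meas: "(\<lambda>z. F (fst z) (snd z)) \<in> borel_measurable (D \<Otimes>\<^sub>M \<rho>)"
    unfolding F_def
    by (intro borel_measurable_scaleR borel_measurable_const borel_measurable_sum borel_measurable_inner
        measurable_compose[OF measurable_fst residual_measurable[OF \<sigma>]] measurable_compose[OF measurable_snd g(1)]
        borel_measurable_pair_continuous[OF param_C1D(2)[OF param_C1_psi] sets_D sets_\<rho>])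
  \<comment> \<open>The bounds hold only on \<open>XX \<times> K\<close>, a closed rectangle of full
    measure, which is enough for integrability over the product.\<close>
  have "AE z in D \<Otimes>\<^sub>M \<rho>. fst z \<in> XX \<and> snd z \<in> K"
  proof (rule P.AE_pair_measure)
    have "closed XX" "closed K" using compact_XX compact_K by (auto intro: compact_imp_closed)
    then have "XX \<in> sets D" "K \<in> sets \<rho>" using sets_D sets_\<rho> by auto
    then have "XX \<times> K \<in> sets (D \<Otimes>\<^sub>M \<rho>)" by (rule pair_measureI)
    moreover have "{z \<in> space (D \<Otimes>\<^sub>M \<rho>). fst z \<in> XX \<and> snd z \<in> K} = XX \<times> K"
      using sets.sets_into_space[OF \<open>XX \<times> K \<in> sets (D \<Otimes>\<^sub>M \<rho>)\<close>] by auto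
    ultimately show "{z \<in> space (D \<Otimes>\<^sub>M \<rho>). fst z \<in> XX \<and> snd z \<in> K} \<in> sets (D \<Otimes>\<^sub>M \<rho>)" by simp
    show "AE X in D. AE \<omega> in \<rho>. fst (X, \<omega>) \<in> XX \<and> snd (X, \<omega>) \<in> K"
      using AE_Kx by (rule eventually_mono) (use prob_measures_onD(3)[OF \<rho>] in \<open>auto elim: eventually_mono\<close>)
  qed
  then have "AE z in D \<Otimes>\<^sub>M \<rho>. norm (F (fst z) (snd z)) \<le> real CARD('dv) * (C * B)"
  proof (rule eventually_mono)
    fix z :: "('dx, 'l) tokens \<times> ('dx, 'dk) head"
    assume z: "fst z \<in> XX \<and> snd z \<in> K"
    show "norm (F (fst z) (snd z)) \<le> real CARD('dv) * (C * B)"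
      unfolding F_def
    proof (intro norm_average_le abs_residual_le)
      show "norm (g (snd z) \<bullet> dq l j (fst z) (snd z)) \<le> C * B" for l j
        using gdq[of "fst z" "snd z" l j] z by simp
    qed
  qed
  then have F_int: "integrable (D \<Otimes>\<^sub>M \<rho>) (\<lambda>(X, \<omega>). F X \<omega>)"
    unfolding case_prod_beta' by (rule P.P.integrable_const_bound[OF _ F_meas])
  have "(LINT \<omega>|\<rho>. g \<omega> \<bullet> grad_variation \<sigma> \<omega>) = (LINT \<omega>|\<rho>. LINT X|D. F X \<omega>)"
  proof (rule integral_cong_AE)
    show "(\<lambda>\<omega>. g \<omega> \<bullet> grad_variation \<sigma> \<omega>) \<in> borel_measurable \<rho>"
      by (intro borel_measurable_inner g(1) grad_variation_measurable \<sigma> sets_\<rho>)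
    show "(\<lambda>\<omega>. LINT X|D. F X \<omega>) \<in> borel_measurable \<rho>"
      by (rule D.borel_measurable_lebesgue_integral)
         (use measurable_compose[OF measurable_pair_swap' F_meas] in \<open>simp add: case_prod_beta'\<close>)
    show "AE \<omega> in \<rho>. g \<omega> \<bullet> grad_variation \<sigma> \<omega> = (LINT X|D. F X \<omega>)"
      using prob_measures_onD(3)[OF \<rho>]
    proof (rule eventually_mono)
      fix \<omega> assume "\<omega> \<in> K"
      let ?f = "\<lambda>X. (1 / real CARD('l)) *\<^sub>R (\<Sum>l\<in>UNIV. \<Sum>j\<in>UNIV. residual \<sigma> l j X *\<^sub>R dq l j X \<omega>)"
      have "AE X in D. norm (?f X) \<le> real CARD('dv) * B"
        by (rule AE_average_bound) (rule B[OF _ \<open>\<omega> \<in> K\<close>])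
      then have "integrable D ?f"
        by (rule D.integrable_const_bound)
           (intro average_measurable \<sigma> section_fst_measurable param_C1D(2)[OF param_C1_psi])
      then have "(LINT X|D. g \<omega> \<bullet> ?f X) = g \<omega> \<bullet> grad_variation \<sigma> \<omega>"
        unfolding grad_variation_def by (intro integral_inner_right)
      moreover have "(\<lambda>X. g \<omega> \<bullet> ?f X) = (\<lambda>X. F X \<omega>)"
        by (rule ext) (simp add: F_def inner_sum_right)
      ultimately show "g \<omega> \<bullet> grad_variation \<sigma> \<omega> = (LINT X|D. F X \<omega>)" by metis
    qed
  qed
  also have "\<dots> = (LINT X|D. LINT \<omega>|\<rho>. F X \<omega>)"
    by (rule P.Fubini_integral[OF F_int])
  also have "\<dots> = (LINT X|D. (1 / real CARD('l)) * (\<Sum>l\<in>UNIV. \<Sum>j\<in>UNIV. residual \<sigma> l j X * (LINT \<omega>|\<rho>. g \<omega> \<bullet> dq l j X \<omega>)))"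
  proof (rule integral_cong_AE)
    show "(\<lambda>X. LINT \<omega>|\<rho>. F X \<omega>) \<in> borel_measurable D"
      by (rule \<rho>.borel_measurable_lebesgue_integral) (use F_meas in \<open>simp add: case_prod_beta'\<close>)
    from average_measurable[OF \<sigma>, of "\<lambda>l j X. LINT \<omega>|\<rho>. g \<omega> \<bullet> dq l j X \<omega>", OF integral_inner_dq_measurable[OF \<rho> g(1)]]
    show "(\<lambda>X. (1 / real CARD('l)) * (\<Sum>l\<in>UNIV. \<Sum>j\<in>UNIV. residual \<sigma> l j X * (LINT \<omega>|\<rho>. g \<omega> \<bullet> dq l j X \<omega>)))
        \<in> borel_measurable D" by simp
    show "AE X in D. (LINT \<omega>|\<rho>. F X \<omega>) = (1 / real CARD('l)) * (\<Sum>l\<in>UNIV. \<Sum>j\<in>UNIV. residual \<sigma> l j X * (LINT \<omega>|\<rho>. g \<omega> \<bullet> dq l j X \<omega>))"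
      using AE_Kx
    proof (rule eventually_mono)
      fix X :: "('dx, 'l) tokens"
      assume X: "\<forall>l. X $ l \<in> Kx"
      have "integrable \<rho> (\<lambda>\<omega>. g \<omega> \<bullet> dq l j X \<omega>)" for l j
      proof (rule \<rho>.integrable_const_bound)
        show "AE \<omega> in \<rho>. norm (g \<omega> \<bullet> dq l j X \<omega>) \<le> C * B"
          using prob_measures_onD(3)[OF \<rho>] by (rule eventually_mono) (use gdq X in simp)
        show "(\<lambda>\<omega>. g \<omega> \<bullet> dq l j X \<omega>) \<in> borel_measurable \<rho>"
          by (intro borel_measurable_inner g(1) dq_measurable sets_\<rho>)
      qed
      then show "(LINT \<omega>|\<rho>. F X \<omega>) = (1 / real CARD('l)) * (\<Sum>l\<in>UNIV. \<Sum>j\<in>UNIV. residual \<sigma> l j X * (LINT \<omega>|\<rho>. g \<omega> \<bullet> dq l j X \<omega>))"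
        unfolding F_def by (simp add: Bochner_Integration.integral_sum)
    qed
  qed
  finally show ?thesis .
qed

lemma narrowly_continuous_integral:
  assumes \<rho>: "\<And>t. t \<in> T \<Longrightarrow> \<rho> t \<in> prob_measures_on K" and nar: "narrowly_continuous_on T \<rho>"
    and h: "continuous_on UNIV h"
  shows "continuous_on T (\<lambda>t. LINT \<omega>|\<rho> t. (h \<omega> :: real))"
proof -
  have "bounded (h ` K)"
    by (intro compact_imp_bounded compact_continuous_image compact_K continuous_on_subset[OF h subset_UNIV])
  then obtain C where C: "\<And>\<omega>. \<omega> \<in> K \<Longrightarrow> \<bar>h \<omega>\<bar> \<le> C" by (auto simp: bounded_iff)
  \<comment> \<open>Narrow continuity tests bounded functions only; clipping h at its bound on K
    changes nothing where the measures live.\<close>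
  define c where "c \<omega> = max (- C) (min C (h \<omega>))" for \<omega>
  have c: "continuous_on UNIV c"
    unfolding c_def by (intro continuous_intros h)
  moreover have "\<bar>c \<omega>\<bar> \<le> \<bar>C\<bar>" for \<omega> by (auto simp: c_def)
  then have "bounded (range c)" by (auto simp: bounded_iff)
  ultimately have "continuous_on T (\<lambda>t. LINT \<omega>|\<rho> t. c \<omega>)"
    using nar by (auto simp: narrowly_continuous_on_def)
  moreover have "(LINT \<omega>|\<rho> t. c \<omega>) = (LINT \<omega>|\<rho> t. h \<omega>)" if "t \<in> T" for t
  proof (rule integral_cong_AE)
    show "AE \<omega> in \<rho> t. c \<omega> = h \<omega>"
      using prob_measures_onD(3)[OF \<rho>[OF that]]
      by (rule eventually_mono) (use C in \<open>force simp: c_def abs_le_iff\<close>)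
    show "c \<in> borel_measurable (\<rho> t)" "h \<in> borel_measurable (\<rho> t)"
      using borel_measurable_continuous_onI[OF c] borel_measurable_continuous_onI[OF h]
        measurable_cong_sets[OF prob_measures_onD(2)[OF \<rho>[OF that]] refl] by blast+
  qed
  ultimately show ?thesis by (simp cong: continuous_on_cong)
qed

end

section \<open>Evolution of the logits and of the risk\<close>

locale attention_flow = attention_data Wout D Y K Kx
  for Wout :: "real^('dv::finite)^('dx::finite)"
    and D :: "(real^'dx^('l::{finite,linorder})) measure"
    and Y :: "'l \<Rightarrow> real^'dx^('l::{finite,linorder}) \<Rightarrow> real^'dv"
    and K :: "('dx, 'dk::finite) head set"
    and Kx :: "(real^'dx) set" +
  fixes \<zeta> :: "real \<Rightarrow> real"
    and \<rho> :: "real \<Rightarrow> ('dx, 'dk) head measure"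
  assumes rate: "learning_rate \<zeta>" and flow: "weak_solution Wout D Y K \<zeta> \<rho>"
begin

section \<open>Continuity in time along the flow\<close>

lemma flow_prob_measure: "t \<ge> 0 \<Longrightarrow> \<rho> t \<in> prob_measures_on K"
  using flow by (simp add: weak_solution_def)

lemma continuous_on_integral_\<rho>:
  "continuous_on UNIV h \<Longrightarrow> continuous_on {0..} (\<lambda>t. LINT \<omega>|\<rho> t. (h \<omega> :: real))"
  using flow_prob_measure flow by (intro narrowly_continuous_integral) (auto simp: weak_solution_def)

lemma continuous_on_psi: "continuous_on UNIV (q l j X)" "continuous_on UNIV (dq l j X)"
proof -
  have "continuous_on UNIV (Pair X :: ('dx, 'dk) head \<Rightarrow> _)" by (simp add: continuous_on_Pair)
  from continuous_on_compose2[OF param_C1D(1)[OF param_C1_psi[of Wout l j]] this subset_UNIV]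
    continuous_on_compose2[OF param_C1D(2)[OF param_C1_psi[of Wout l j]] this subset_UNIV]
  show "continuous_on UNIV (q l j X)" "continuous_on UNIV (dq l j X)" by simp_all
qed

lemma continuous_on_logits:
  fixes l :: 'l
  shows "continuous_on {0..} (\<lambda>t. logits Wout (\<rho> t) l X $ j)"
  using continuous_on_integral_\<rho>[OF continuous_on_psi(1)[of l X j]]
  by (rule continuous_on_cong[THEN iffD1, rotated -1]) (simp_all add: logits_nth flow_prob_measure)

lemma continuous_on_residual: "continuous_on {0..} (\<lambda>t. residual (\<rho> t) l j X)"
  unfolding softmax_nth
  by (intro continuous_on_diff continuous_on_divide continuous_on_exp continuous_on_sum
      continuous_on_logits continuous_on_const ballI less_imp_neq[THEN not_sym] sum_exp_pos)

text \<open>The velocity of a logit, up to the factor \<open>- 2 * \<zeta> t\<close>.\<close>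

definition slope :: "'l \<Rightarrow> 'dv \<Rightarrow> ('dx, 'l) tokens \<Rightarrow> real \<Rightarrow> real" where
  "slope l j X t = (LINT \<omega>|\<rho> t. dq l j X \<omega> \<bullet> grad_variation (\<rho> t) \<omega>)"

text \<open>Narrow continuity does not apply to the defining integral, whose integrand changes with
  t. After Fubini, t enters only through residuals and integrals of fixed continuous functions;
  these are continuous for each second input X', and bounded convergence passes to the
  average.\<close>

lemma continuous_on_slope: "continuous_on {0..} (slope l j X)"
proof -
  \<comment> \<open>Two constants, because the fixed X is arbitrary and may lie outside
    \<open>XX\<close>, whereas X' ranges over almost every input.\<close>
  obtain C where C: "\<forall>Z\<in>{X}. \<forall>\<omega>\<in>K. \<forall>l j. \<bar>q l j Z \<omega>\<bar> \<le> C \<and> norm (dq l j Z \<omega>) \<le> C"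
    using psi_bounded[OF finite_imp_compact compact_K, of "{X}"] by blast
  obtain B where B: "\<forall>X\<in>XX. \<forall>\<omega>\<in>K. \<forall>l j. \<bar>q l j X \<omega>\<bar> \<le> B \<and> norm (dq l j X \<omega>) \<le> B"
    using psi_bounded[OF compact_XX compact_K] by blast
  \<comment> \<open>The tangent kernel of the averaged model, comparing one logit at X with another
    at X'.\<close>
  let ?J = "\<lambda>l' j' X' t. LINT \<omega>|\<rho> t. dq l j X \<omega> \<bullet> dq l' j' X' \<omega>"
  let ?h = "\<lambda>t X'. (1 / real CARD('l)) *\<^sub>R (\<Sum>l'\<in>UNIV. \<Sum>j'\<in>UNIV. residual (\<rho> t) l' j' X' *\<^sub>R ?J l' j' X' t)"
  have J_bound: "norm (?J l' j' X' t) \<le> C * B" if "X' \<in> XX" "t \<in> {0..}" for l' j' X' t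
  proof -
    interpret prob_space "\<rho> t" using flow_prob_measure that by (intro prob_measures_onD) simp
    have ae: "AE \<omega> in \<rho> t. norm (dq l j X \<omega> \<bullet> dq l' j' X' \<omega>) \<le> C * B"
    proof (rule eventually_mono)
      show "AE \<omega> in \<rho> t. \<omega> \<in> K" using flow_prob_measure that by (intro prob_measures_onD) simp
      fix \<omega> assume "\<omega> \<in> K"
      then have n: "norm (dq l j X \<omega>) \<le> C" "norm (dq l' j' X' \<omega>) \<le> B" using B C that(1) by blast+
      have "norm (dq l j X \<omega> \<bullet> dq l' j' X' \<omega>) \<le> norm (dq l j X \<omega>) * norm (dq l' j' X' \<omega>)"
        by (simp add: Cauchy_Schwarz_ineq2)
      also have "\<dots> \<le> C * B"
        using order_trans[OF norm_ge_zero n(1)] by (intro mult_mono n) auto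
      finally show "norm (dq l j X \<omega> \<bullet> dq l' j' X' \<omega>) \<le> C * B" .
    qed
    show ?thesis
      using flow_prob_measure that
      by (intro norm_integral_le_const[OF _ ae] borel_measurable_inner dq_measurable prob_measures_onD(2)) auto
  qed
  have "continuous_on {0..} (\<lambda>t. LINT X'|D. ?h t X')"
  proof (rule D.continuous_on_integral_bounded)
    show "AE X' in D. continuous_on {0..} (\<lambda>t. ?h t X')"
    proof (rule AE_I2)
      fix X'
      have J: "continuous_on {0..} (?J l' j' X')" for l' j'
        by (rule continuous_on_integral_\<rho>[OF continuous_on_inner[OF continuous_on_psi(2) continuous_on_psi(2)]])
      show "continuous_on {0..} (\<lambda>t. ?h t X')"
        by (intro continuous_on_scaleR continuous_on_const continuous_on_sum continuous_on_residual J)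
    qed
    fix t :: real assume t: "t \<in> {0..}"
    then have \<rho>t: "\<rho> t \<in> prob_measures_on K" by (simp add: flow_prob_measure)
    show "?h t \<in> borel_measurable D"
      by (intro average_measurable \<rho>t integral_inner_dq_measurable dq_measurable prob_measures_onD(2)[OF \<rho>t])
    show "AE X' in D. \<bar>?h t X'\<bar> \<le> real CARD('dv) * (C * B)"
      using AE_average_bound[of "\<lambda>l' j' X'. ?J l' j' X' t" "C * B" "\<rho> t", OF J_bound[OF _ t]] by simp
  qed
  moreover have "(LINT X'|D. ?h t X') = slope l j X t" if "t \<in> {0..}" for t
  proof -
    have \<rho>t: "\<rho> t \<in> prob_measures_on K" using flow_prob_measure that by simp
    show ?thesis
      using integral_inner_grad_variation[OF \<rho>t \<rho>t, where g="dq l j X" and C=C]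
        dq_measurable[OF prob_measures_onD(2)[OF \<rho>t]] C
      by (simp add: slope_def)
  qed
  ultimately show ?thesis by (rule continuous_on_eq)
qed

lemma slope_measurable:
  assumes "t \<ge> 0"
  shows "(\<lambda>X. slope l j X t) \<in> borel_measurable D"
  unfolding slope_def
  using integral_inner_dq_measurable[OF flow_prob_measure[OF assms] grad_variation_measurable[OF flow_prob_measure[OF assms]
      prob_measures_onD(2)[OF flow_prob_measure[OF assms]]]]
  by (simp add: inner_commute)

text \<open>By Cauchy-Schwarz: B bounds the gradient of the logit and
  \<open>real CARD('dv) * B\<close> that of the first variation. The bound is uniform in time, as
  differentiating the risk under the expectation requires.\<close>

lemma abs_slope_le:
  assumes "t \<ge> 0" "X \<in> XX" and B: "\<And>l j X \<omega>. X \<in> XX \<Longrightarrow> \<omega> \<in> K \<Longrightarrow> norm (dq l j X \<omega>) \<le> B"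
  shows "\<bar>slope l j X t\<bar> \<le> B * (real CARD('dv) * B)"
proof -
  note \<rho>t = flow_prob_measure[OF assms(1)]
  interpret prob_space "\<rho> t" by (rule prob_measures_onD[OF \<rho>t])
  note sets_\<rho>t = prob_measures_onD(2)[OF \<rho>t]
  have ae: "AE \<omega> in \<rho> t. norm (dq l j X \<omega> \<bullet> grad_variation (\<rho> t) \<omega>) \<le> B * (real CARD('dv) * B)"
    using prob_measures_onD(3)[OF \<rho>t]
  proof (rule eventually_mono)
    fix \<omega> assume \<omega>: "\<omega> \<in> K"
    have "norm (dq l j X \<omega> \<bullet> grad_variation (\<rho> t) \<omega>) \<le> norm (dq l j X \<omega>) * norm (grad_variation (\<rho> t) \<omega>)"
      by (simp add: Cauchy_Schwarz_ineq2)
    also have "\<dots> \<le> B * (real CARD('dv) * B)"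
      using order_trans[OF norm_ge_zero B[OF assms(2) \<omega>]]
      by (intro mult_mono B assms(2) \<omega> norm_grad_variation_le \<rho>t) auto
    finally show "norm (dq l j X \<omega> \<bullet> grad_variation (\<rho> t) \<omega>) \<le> B * (real CARD('dv) * B)" .
  qed
  have "norm (slope l j X t) \<le> B * (real CARD('dv) * B)"
    unfolding slope_def
    by (intro norm_integral_le_const[OF _ ae] borel_measurable_inner dq_measurable sets_\<rho>t
        grad_variation_measurable \<rho>t)
  then show ?thesis by simp
qed

lemma set_integral_K:
  fixes h :: "('dx, 'dk) head \<Rightarrow> real"
  assumes "t \<ge> 0" "h \<in> borel_measurable (\<rho> t)"
  shows "(LINT \<omega>:K|\<rho> t. h \<omega>) = (LINT \<omega>|\<rho> t. h \<omega>)"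
  unfolding set_lebesgue_integral_def
proof (rule integral_cong_AE)
  show "AE \<omega> in \<rho> t. indicator K \<omega> *\<^sub>R h \<omega> = h \<omega>"
    using prob_measures_onD(3)[OF flow_prob_measure[OF assms(1)]] by (rule eventually_mono) simp
  have "K \<in> sets (\<rho> t)"
    using compact_imp_closed[OF compact_K] prob_measures_onD(2)[OF flow_prob_measure[OF assms(1)]] by simp
  then show "(\<lambda>\<omega>. indicator K \<omega> *\<^sub>R h \<omega>) \<in> borel_measurable (\<rho> t)"
    by (intro borel_measurable_scaleR borel_measurable_indicator assms(2))
qed (rule assms(2))

text \<open>Valid for every X, without an exceptional set, since each coordinate of
  \<open>psi\<close> is a test function whatever the input. Continuity of \<zeta> comes from its
  Lipschitz bound.\<close>

lemma logits_has_derivative: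
  assumes "t \<ge> 0"
  shows "((\<lambda>s. logits Wout (\<rho> s) l X $ j) has_real_derivative - 2 * \<zeta> t * slope l j X t) (at t within {0..})"
proof -
  let ?F = "\<lambda>t. logits Wout (\<rho> t) l X $ j"
  let ?G = "\<lambda>t. - 2 * \<zeta> t * slope l j X t"
  have "C1_on K (q l j X)" by (rule param_C1_imp_C1_on[OF param_C1_psi])
  with flow have "has_distributional_derivative (\<lambda>t. LINT \<omega>:K|\<rho> t. q l j X \<omega>)
      (\<lambda>t. - 2 * \<zeta> t * (LINT \<omega>:K|\<rho> t. dq l j X \<omega> \<bullet> grad (first_variation Wout D Y (\<rho> t)) \<omega>))"
    unfolding weak_solution_def by blast
  moreover have "(LINT \<omega>:K|\<rho> s. q l j X \<omega>) = ?F s" if "s > 0" for s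
    using that by (simp add: logits_nth flow_prob_measure set_integral_K q_measurable prob_measures_onD(2))
  moreover have "(LINT \<omega>:K|\<rho> s. dq l j X \<omega> \<bullet> grad (first_variation Wout D Y (\<rho> s)) \<omega>) = slope l j X s"
    if "s > 0" for s
  proof -
    have \<rho>s: "\<rho> s \<in> prob_measures_on K" using flow_prob_measure that by simp
    have "(\<lambda>\<omega>. dq l j X \<omega> \<bullet> grad_variation (\<rho> s) \<omega>) \<in> borel_measurable (\<rho> s)"
      by (intro borel_measurable_inner dq_measurable grad_variation_measurable \<rho>s prob_measures_onD(2)[OF \<rho>s])
    then show ?thesis
      using that by (simp add: slope_def grad_first_variation[OF \<rho>s] set_integral_K)
  qed
  ultimately have "has_distributional_derivative ?F ?G"
    by - (erule has_distributional_derivative_cong, simp_all)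
  moreover have "continuous_on {0..} \<zeta>"
    using rate by (auto simp: learning_rate_def intro: lipschitz_on_continuous_on)
  then have "continuous_on {0..} ?G"
    by (intro continuous_on_mult continuous_on_const continuous_on_slope)
  ultimately show ?thesis
    using assms by (intro has_distributional_derivative_imp_derivative continuous_on_logits)
qed

text \<open>The chain rule through the cross entropy holds for each input; the expectation is
  handled by \<open>has_derivative_integral_bounded\<close> on the half-line, where boundedness of
  \<zeta> makes the dominating constant independent of time.\<close>

lemma risk_has_derivative:
  assumes "t \<ge> 0"
  shows "((\<lambda>s. risk Wout D Y (\<rho> s)) has_real_derivative - 2 * \<zeta> t * dissipation Wout D Y (\<rho> t)) (at t within {0..})"
proof -
  obtain B where *: "\<forall>X\<in>XX. \<forall>\<omega>\<in>K. \<forall>l j. \<bar>q l j X \<omega>\<bar> \<le> B \<and> norm (dq l j X \<omega>) \<le> B"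
    using psi_bounded[OF compact_XX compact_K] by blast
  then have B: "\<And>l j X \<omega>. X \<in> XX \<Longrightarrow> \<omega> \<in> K \<Longrightarrow> \<bar>q l j X \<omega>\<bar> \<le> B"
    "\<And>l j X \<omega>. X \<in> XX \<Longrightarrow> \<omega> \<in> K \<Longrightarrow> norm (dq l j X \<omega>) \<le> B" by blast+
  obtain Z where "\<forall>x\<in>\<zeta> ` {0..}. norm x \<le> Z"
    using rate unfolding learning_rate_def bounded_iff by blast
  then have Z: "\<And>s. s \<ge> 0 \<Longrightarrow> \<bar>\<zeta> s\<bar> \<le> Z" by simp
  \<comment> \<open>Bounds a logit velocity: 2 from the equation, Z from the learning rate, the rest
    from \<open>abs_slope_le\<close>.\<close>
  let ?C = "2 * Z * (B * (real CARD('dv) * B))"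
  define f where "f s X = (1 / real CARD('l)) * (\<Sum>l\<in>UNIV. cross_entropy (Y l X) (logits Wout (\<rho> s) l X))" for s X
  define g where "g s X = (1 / real CARD('l)) *\<^sub>R
    (\<Sum>l\<in>UNIV. \<Sum>j\<in>UNIV. residual (\<rho> s) l j X *\<^sub>R (- 2 * \<zeta> s * slope l j X s))" for s X
  have inner_eq: "(\<lambda>h. h \<bullet> c) = (*) c" for c :: real
    by (simp add: fun_eq_iff mult.commute)
  have slope_bound: "norm (- 2 * \<zeta> s * slope l j X s) \<le> ?C" if "s \<ge> 0" "X \<in> XX" for s l j X
  proof -
    have "\<bar>\<zeta> s\<bar> * \<bar>slope l j X s\<bar> \<le> Z * (B * (real CARD('dv) * B))"
      using Z[OF that(1)] abs_slope_le[OF that B(2)] by (intro mult_mono) auto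
    then show ?thesis by (simp add: abs_mult)
  qed
  have "((\<lambda>s. LINT X|D. f s X) has_derivative (\<lambda>h. h \<bullet> (LINT X|D. g t X))) (at t within {0..})"
  proof (rule D.has_derivative_integral_bounded)
    show "integrable D (f s)" if "s \<in> {0..}" for s
    proof (rule D.integrable_const_bound)
      have \<rho>s: "\<rho> s \<in> prob_measures_on K" using that flow_prob_measure by simp
      have "(\<lambda>X. cross_entropy (Y l X) (logits Wout (\<rho> s) l X)) \<in> borel_measurable D" for l
        unfolding cross_entropy_def inner_vec_def inner_real_def
        by (intro borel_measurable_diff borel_measurable_sum borel_measurable_times Y_measurable
            logits_nth_measurable[OF \<rho>s] borel_measurable_ln
            measurable_compose[OF logits_nth_measurable[OF \<rho>s] borel_measurable_exp])
      then show "f s \<in> borel_measurable D"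
        unfolding f_def by (intro borel_measurable_times borel_measurable_const borel_measurable_sum)
      show "AE X in D. norm (f s X) \<le> real CARD('dv) * exp B + 2 * B"
        using AE_Kx
      proof (rule eventually_mono)
        fix X :: "('dx, 'l) tokens" assume X: "\<forall>l. X $ l \<in> Kx"
        have "\<bar>cross_entropy (Y l X) (logits Wout (\<rho> s) l X)\<bar> \<le> real CARD('dv) * exp B + 2 * B" for l
          using data X B(1)[of X] by (intro abs_cross_entropy_le abs_logits_le \<rho>s) (auto simp: data_model_def)
        then have "(\<Sum>l\<in>UNIV. \<bar>cross_entropy (Y l X) (logits Wout (\<rho> s) l X)\<bar>)
            \<le> (\<Sum>l\<in>(UNIV::'l set). real CARD('dv) * exp B + 2 * B)"
          by (intro sum_mono)
        then have "\<bar>\<Sum>l\<in>UNIV. cross_entropy (Y l X) (logits Wout (\<rho> s) l X)\<bar>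
            \<le> real CARD('l) * (real CARD('dv) * exp B + 2 * B)"
          using order_trans[OF sum_abs] by simp
        then show "norm (f s X) \<le> real CARD('dv) * exp B + 2 * B"
          by (simp add: f_def abs_mult field_simps)
      qed
    qed
    show "g t \<in> borel_measurable D"
      unfolding g_def
      by (intro average_measurable flow_prob_measure assms borel_measurable_times borel_measurable_const slope_measurable)
    show "AE X in D. \<forall>s\<in>{0..}. norm (g s X) \<le> real CARD('dv) * ?C"
      using AE_Kx
    proof (rule eventually_mono)
      fix X :: "('dx, 'l) tokens" assume X: "\<forall>l. X $ l \<in> Kx"
      show "\<forall>s\<in>{0..}. norm (g s X) \<le> real CARD('dv) * ?C"
      proof
        fix s :: real assume "s \<in> {0..}"
        then show "norm (g s X) \<le> real CARD('dv) * ?C"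
          unfolding g_def by (intro norm_average_le abs_residual_le slope_bound) (use X in auto)
      qed
    qed
    show "AE X in D. \<forall>s\<in>{0..}. ((\<lambda>s. f s X) has_derivative (\<lambda>h. h \<bullet> g s X)) (at s within {0..})"
    proof (intro AE_I2 ballI)
      fix X and s :: real assume s: "s \<in> {0..}"
      have "((\<lambda>s. f s X) has_real_derivative g s X) (at s within {0..})"
        unfolding f_def g_def real_scaleR_def using s
        by (intro DERIV_cmult DERIV_sum has_derivative_cross_entropy logits_has_derivative) simp
      then show "((\<lambda>s. f s X) has_derivative (\<lambda>h. h \<bullet> g s X)) (at s within {0..})"
        unfolding inner_eq has_field_derivative_def .
    qed
  qed (use assms in auto)
  then have "((\<lambda>s. risk Wout D Y (\<rho> s)) has_real_derivative (LINT X|D. g t X)) (at t within {0..})"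
    unfolding inner_eq has_field_derivative_def risk_def f_def .
  moreover have "(LINT X|D. g t X) = - 2 * \<zeta> t * dissipation Wout D Y (\<rho> t)"
  proof -
    note \<rho>t = flow_prob_measure[OF assms]
    \<comment> \<open>The scalar \<open>- 2 * \<zeta> t\<close> comes out of the sums, leaving the
      integrand of \<open>integral_inner_grad_variation\<close> with g the gradient of the first
      variation. Its inner product with itself is the squared norm in the dissipation.\<close>
    have "g t X = - 2 * \<zeta> t * ((1 / real CARD('l)) *
        (\<Sum>l\<in>UNIV. \<Sum>j\<in>UNIV. residual (\<rho> t) l j X * (LINT \<omega>|\<rho> t. grad_variation (\<rho> t) \<omega> \<bullet> dq l j X \<omega>)))" for X
      by (simp add: g_def slope_def sum_distrib_left inner_commute mult_ac)
    then have "(LINT X|D. g t X) = - 2 * \<zeta> t * (LINT \<omega>|\<rho> t. grad_variation (\<rho> t) \<omega> \<bullet> grad_variation (\<rho> t) \<omega>)"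
      using integral_inner_grad_variation[OF \<rho>t \<rho>t grad_variation_measurable[OF \<rho>t prob_measures_onD(2)[OF \<rho>t]]
          norm_grad_variation_le[OF B(2) \<rho>t]] by simp
    then show ?thesis
      by (simp add: dissipation_def grad_first_variation[OF \<rho>t] power2_norm_eq_inner)
  qed
  ultimately show ?thesis by simp
qed

end

theorem theorem6p1:
  fixes Wout :: "real^('dv::finite)^('dx::finite)"
    and D :: "(real^'dx^('l::{finite,linorder})) measure"
    and Y :: "'l \<Rightarrow> real^'dx^('l::{finite,linorder}) \<Rightarrow> real^'dv"
    and K :: "('dx, 'dk::finite) head set"
    and Kx :: "(real^'dx) set"
    and \<zeta> :: "real \<Rightarrow> real"
    and \<rho> :: "real \<Rightarrow> ('dx, 'dk) head measure"
  assumes "data_model D Y"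
    and "learning_rate \<zeta>"
    and "smoothness Wout D K Kx"
    and "weak_solution Wout D Y K \<zeta> \<rho>"
  shows "(\<forall>t\<ge>0.
            ((\<lambda>s. risk Wout D Y (\<rho> s)) has_real_derivative
               - 2 * \<zeta> t * dissipation Wout D Y (\<rho> t)) (at t within {0..})
            \<and> - 2 * \<zeta> t * dissipation Wout D Y (\<rho> t) \<le> 0)
         \<and> antimono_on {0..} (\<lambda>t. risk Wout D Y (\<rho> t))"
proof -
  interpret attention_flow Wout D Y K Kx \<zeta> \<rho>
    using assms by unfold_locales (auto simp: smoothness_def)
  let ?R = "\<lambda>s. risk Wout D Y (\<rho> s)"
  note deriv = risk_has_derivative
  have nonpos: "- 2 * \<zeta> t * dissipation Wout D Y (\<rho> t) \<le> 0" if "t \<ge> 0" for t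
  proof -
    have "0 \<le> \<zeta> t" using assms(2) that by (simp add: learning_rate_def)
    moreover have "0 \<le> dissipation Wout D Y (\<rho> t)" by (simp add: dissipation_def)
    ultimately show ?thesis by simp
  qed
  have "?R b \<le> ?R a" if "0 \<le> a" "a \<le> b" for a b
  proof (rule DERIV_nonpos_imp_decreasing_open[OF that(2)])
    \<comment> \<open>At positive times the derivative within \<open>{0..}\<close> is two-sided.
      Time 0 can occur only as the endpoint a, where continuity suffices.\<close>
    show "\<exists>y. (?R has_real_derivative y) (at x) \<and> y \<le> 0" if "a < x" "x < b" for x
    proof -
      have "x > 0" using that \<open>0 \<le> a\<close> by simp
      then have "at x within {0..} = at x" by (intro at_within_interior) simp
      then show ?thesis using deriv[of x] nonpos[of x] \<open>x > 0\<close> by auto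
    qed
    have "continuous_on {0..} ?R"
      using deriv DERIV_continuous unfolding continuous_on_eq_continuous_within by (metis atLeast_iff)
    then show "continuous_on {a..b} ?R"
      by (rule continuous_on_subset) (use \<open>0 \<le> a\<close> in auto)
  qed
  then have "antimono_on {0..} ?R"
    by (auto intro!: monotone_onI)
  with deriv nonpos show ?thesis by blast
qed

end
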